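(* Let $(L,[\cdot,\cdot,\cdot])$ be a Lie triple system, $(M,\theta)$ a representation of it, $\mathcal H$ a 3-cocycle of $L$ with coefficients in $(M,\theta)$, and $T:M\to L$ a generalized Reynolds operator. Let $T_\lambda=\sum_{i=0}^n\lambda^iT_i$ be an order $n$ deformation of $T$. Then $T_\lambda$ is extendable if and only if the cohomology class $[Obs^T]\in \mathbf H^3_T(M,L)$ is trivial, where $Obs^T$ is the 3-cochain defined by $$\begin{aligned}Obs^T(u,v,w)=&\sum_{\substack{0\le i,j,k\le n\\ i+j+k=n+1}}\Big([T_iu,T_jv,T_kw]-T_i\big(D(T_ju,T_kv)w+\theta(T_jv,T_kw)u-\theta(T_ju,T_kw)v\big)\Big)\\&-\sum_{\substack{0\le i,j,k,l\le n\\ i+j+k+l=n+1}}T_i\,\mathcal H(T_ju,T_kv,T_lw).\end{aligned}$$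
   Context: All vector spaces are over a field $\mathbb K$ of characteristic $0$. A Lie triple system (L.t.s.) is a vector space $L$ with a trilinear bracket satisfying $[x,x,y]=0$, $[x,y,z]+[y,z,x]+[z,x,y]=0$ and $[x,y,[z,t,e]]=[[x,y,z],t,e]+[z,[x,y,t],e]+[z,t,[x,y,e]]$ for all elements. A representation of an L.t.s. $L$ on a vector space $M$ is a bilinear map $\theta:L\times L\to \mathrm{End}(M)$ such that, with $D(x,y):=\theta(y,x)-\theta(x,y)$, $\theta(z,t)\theta(x,y)-\theta(y,t)\theta(x,z)-\theta(x,[y,z,t])+D(y,z)\theta(x,t)=0$ and $\theta(z,t)D(x,y)-D(x,y)\theta(z,t)+\theta([x,y,z],t)+\theta(z,[x,y,t])=0$. A 3-cocycle is a trilinear map $\mathcal H:L\times L\times L\to M$ with $\mathcal H(x,x,y)=0$, $\mathcal H(x,y,z)+\mathcal H(y,z,x)+\mathcal H(z,x,y)=0$ and $\mathcal H(x_1,x_2,[y_1,y_2,y_3])+D(x_1,x_2)\mathcal H(y_1,y_2,y_3)-\mathcal H([x_1,x_2,y_1],y_2,y_3)-\mathcal H(y_1,[x_1,x_2,y_2],y_3)=\mathcal H(y_1,y_2,[x_1,x_2,y_3])+\theta(y_2,y_3)\mathcal H(x_1,x_2,y_1)-\theta(y_1,y_3)\mathcal H(x_1,x_2,y_2)+D(y_1,y_2)\mathcal H(x_1,x_2,y_3)$. A linear map $T:M\to L$ is a generalized Reynolds operator if for all $u,v,w\in M$ $[Tu,Tv,Tw]=T\big(D(Tu,Tv)w+\theta(Tv,Tw)u-\theta(Tu,Tw)v+\mathcal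 H(Tu,Tv,Tw)\big)$. Then $M$ is an L.t.s. with $[u,v,w]_T=\theta(Tv,Tw)u-\theta(Tu,Tw)v+D(Tu,Tv)w+\mathcal H(Tu,Tv,Tw)$, and $L$ is a representation of it via $\theta_T(u,v)x=[x,Tu,Tv]-T\big(D(x,Tu)v-\theta(x,Tv)u+\mathcal H(x,Tu,Tv)\big)$; put $D_T(u,v)=\theta_T(v,u)-\theta_T(u,v)$. Cohomology: $1$-cochains are linear maps $M\to L$; for $m\ge1$, $(2m+1)$-cochains are multilinear maps $\varphi:M^{2m+1}\to L$ with $\varphi(v_1,\dots,v_{2m-2},v,v,u)=0$ and vanishing cyclic sum over the last three arguments. The coboundary from $(2m-1)$- to $(2m+1)$-cochains ($m\ge1$) is $$\begin{aligned}\delta_T^{2m-1}\varphi(v_1,\dots,v_{2m+1})=&\theta_T(v_{2m},v_{2m+1})\varphi(v_1,\dots,v_{2m-1})-\theta_T(v_{2m-1},v_{2m+1})\varphi(v_1,\dots,v_{2m-2},v_{2m})\\&+\sum_{k=1}^m(-1)^{m+k}D_T(v_{2k-1},v_{2k})\varphi(v_1,\dots,\widehat{v}_{2k-1},\widehat v_{2k},\dots,v_{2m+1})\\&+\sum_{k=1}^m\sum_{j=2k+1}^{2m+1}(-1)^{m+k+1}\varphi(v_1,\dots,\widehat v_{2k-1},\widehat v_{2k},\dots,[v_{2k-1},v_{2k},v_j]_T,\dots,v_{2m+1}).\end{aligned}$$ $\mathbf H^3_T(M,L)=\ker\delta_T^3/\operatorname{im}\delta_T^1$. Order $n$ deformation: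 $T_\lambda=\sum_{i=0}^n\lambda^iT_i$ with $T_i:M\to L$ linear, $T_0=T$, such that $[T_\lambda u,T_\lambda v,T_\lambda w]=T_\lambda\big(D(T_\lambda u,T_\lambda v)w+\theta(T_\lambda v,T_\lambda w)u-\theta(T_\lambda u,T_\lambda w)v+\mathcal H(T_\lambda u,T_\lambda v,T_\lambda w)\big)$ holds modulo $\lambda^{n+1}$ for all $u,v,w\in M$, all structures being extended $\lambda$-linearly to $L[[\lambda]]/\lambda^{n+1}$ and $M[[\lambda]]/\lambda^{n+1}$. It is extendable if there is a linear map $T_{n+1}:M\to L$ such that $T_\lambda+\lambda^{n+1}T_{n+1}$ is an order $n+1$ deformation of $T$. *)

theory Defs
  imports "HOL-Computational_Algebra.Formal_Power_Series"
begin

text \<open>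
  Vector spaces are types of class \<open>ab_group_add\<close> with an explicit scalar multiplication
  (\<open>sL\<close> on \<open>L\<close>, \<open>sM\<close> on \<open>M\<close>) over a field \<open>'k\<close> of characteristic \<open>0\<close>;
  dimensions are arbitrary.
\<close>

definition trilinear ::
  "('k::field \<Rightarrow> 'a::ab_group_add \<Rightarrow> 'a) \<Rightarrow> ('k \<Rightarrow> 'b::ab_group_add \<Rightarrow> 'b) \<Rightarrow>
   ('k \<Rightarrow> 'c::ab_group_add \<Rightarrow> 'c) \<Rightarrow> ('k \<Rightarrow> 'd::ab_group_add \<Rightarrow> 'd) \<Rightarrow>
   ('a \<Rightarrow> 'b \<Rightarrow> 'c \<Rightarrow> 'd) \<Rightarrow> bool" where
  "trilinear s1 s2 s3 s f \<longleftrightarrow>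
     (\<forall>y z. Vector_Spaces.linear s1 s (\<lambda>x. f x y z)) \<and>
     (\<forall>x z. Vector_Spaces.linear s2 s (\<lambda>y. f x y z)) \<and>
     (\<forall>x y. Vector_Spaces.linear s3 s (\<lambda>z. f x y z))"

locale lie_triple_system = vector_space sL
  for sL :: "'k::field_char_0 \<Rightarrow> 'l::ab_group_add \<Rightarrow> 'l" +
  fixes br :: "'l \<Rightarrow> 'l \<Rightarrow> 'l \<Rightarrow> 'l"
  assumes br_trilinear: "trilinear sL sL sL sL br"
    and br_alt: "br x x y = 0"
    and br_cyclic: "br x y z + br y z x + br z x y = 0"
    and br_derivation:
      "br x y (br z t e) = br (br x y z) t e + br z (br x y t) e + br z t (br x y e)"

definition rep_D :: "('l \<Rightarrow> 'l \<Rightarrow> 'm \<Rightarrow> 'm::ab_group_add) \<Rightarrow> 'l \<Rightarrow> 'l \<Rightarrow> 'm \<Rightarrow> 'm" where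
  "rep_D \<theta> x y u = \<theta> y x u - \<theta> x y u"

text \<open>
  A bilinear map \<open>L \<times> L \<rightarrow> End(M)\<close> is curried to a map that is linear in both arguments from \<open>L\<close>
  and in the argument from \<open>M\<close>; products in \<open>End(M)\<close> are compositions.
\<close>

locale lts_representation =
  lie_triple_system sL br + M: vector_space sM
  for sL :: "'k::field_char_0 \<Rightarrow> 'l::ab_group_add \<Rightarrow> 'l"
    and br :: "'l \<Rightarrow> 'l \<Rightarrow> 'l \<Rightarrow> 'l"
    and sM :: "'k \<Rightarrow> 'm::ab_group_add \<Rightarrow> 'm" +
  fixes \<theta> :: "'l \<Rightarrow> 'l \<Rightarrow> 'm \<Rightarrow> 'm"
  assumes rep_trilinear: "trilinear sL sL sM sM \<theta>"
    and rep_1: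
      "\<theta> z t (\<theta> x y u) - \<theta> y t (\<theta> x z u) - \<theta> x (br y z t) u + rep_D \<theta> y z (\<theta> x t u) = 0"
    and rep_2:
      "\<theta> z t (rep_D \<theta> x y u) - rep_D \<theta> x y (\<theta> z t u)
         + \<theta> (br x y z) t u + \<theta> z (br x y t) u = 0"

locale lts_3_cocycle = lts_representation sL br sM \<theta>
  for sL :: "'k::field_char_0 \<Rightarrow> 'l::ab_group_add \<Rightarrow> 'l"
    and br :: "'l \<Rightarrow> 'l \<Rightarrow> 'l \<Rightarrow> 'l"
    and sM :: "'k \<Rightarrow> 'm::ab_group_add \<Rightarrow> 'm"
    and \<theta> :: "'l \<Rightarrow> 'l \<Rightarrow> 'm \<Rightarrow> 'm" +
  fixes H :: "'l \<Rightarrow> 'l \<Rightarrow> 'l \<Rightarrow> 'm"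
  assumes H_trilinear: "trilinear sL sL sL sM H"
    and H_alt: "H x x y = 0"
    and H_cyclic: "H x y z + H y z x + H z x y = 0"
    and H_cocycle:
      "H x1 x2 (br y1 y2 y3) + rep_D \<theta> x1 x2 (H y1 y2 y3)
         - H (br x1 x2 y1) y2 y3 - H y1 (br x1 x2 y2) y3
       = H y1 y2 (br x1 x2 y3) + \<theta> y2 y3 (H x1 x2 y1)
         - \<theta> y1 y3 (H x1 x2 y2) + rep_D \<theta> y1 y2 (H x1 x2 y3)"

locale generalized_reynolds = lts_3_cocycle sL br sM \<theta> H
  for sL :: "'k::field_char_0 \<Rightarrow> 'l::ab_group_add \<Rightarrow> 'l"
    and br :: "'l \<Rightarrow> 'l \<Rightarrow> 'l \<Rightarrow> 'l"
    and sM :: "'k \<Rightarrow> 'm::ab_group_add \<Rightarrow> 'm"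
    and \<theta> :: "'l \<Rightarrow> 'l \<Rightarrow> 'm \<Rightarrow> 'm"
    and H :: "'l \<Rightarrow> 'l \<Rightarrow> 'l \<Rightarrow> 'm" +
  fixes T :: "'m \<Rightarrow> 'l"
  assumes T_linear: "Vector_Spaces.linear sM sL T"
    and T_reynolds:
      "br (T u) (T v) (T w)
       = T (rep_D \<theta> (T u) (T v) w + \<theta> (T v) (T w) u - \<theta> (T u) (T w) v + H (T u) (T v) (T w))"


section \<open>The cohomology of a generalized Reynolds operator\<close>

definition bracket_T ::
  "('l \<Rightarrow> 'l \<Rightarrow> 'm \<Rightarrow> 'm::ab_group_add) \<Rightarrow> ('l \<Rightarrow> 'l \<Rightarrow> 'l \<Rightarrow> 'm) \<Rightarrow> ('m \<Rightarrow> 'l) \<Rightarrow>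
   'm \<Rightarrow> 'm \<Rightarrow> 'm \<Rightarrow> 'm" where
  "bracket_T \<theta> H T u v w =
     \<theta> (T v) (T w) u - \<theta> (T u) (T w) v + rep_D \<theta> (T u) (T v) w + H (T u) (T v) (T w)"

definition theta_T ::
  "('l \<Rightarrow> 'l \<Rightarrow> 'l \<Rightarrow> 'l::ab_group_add) \<Rightarrow> ('l \<Rightarrow> 'l \<Rightarrow> 'm \<Rightarrow> 'm::ab_group_add) \<Rightarrow>
   ('l \<Rightarrow> 'l \<Rightarrow> 'l \<Rightarrow> 'm) \<Rightarrow> ('m \<Rightarrow> 'l) \<Rightarrow> 'm \<Rightarrow> 'm \<Rightarrow> 'l \<Rightarrow> 'l" where
  "theta_T br \<theta> H T u v x =
     br x (T u) (T v) - T (rep_D \<theta> x (T u) v - \<theta> x (T v) u + H x (T u) (T v))"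

text \<open>
  A map \<open>M\<^sup>n \<rightarrow> L\<close> is a function on lists that vanishes on all lists of length other than \<open>n\<close>, so
  that equality of functions is equality of maps. The argument written \<open>v\<^sub>i\<close> in the usual notation
  is \<open>vs ! (i - 1)\<close>.
\<close>

definition multilinear ::
  "('k::field \<Rightarrow> 'm::ab_group_add \<Rightarrow> 'm) \<Rightarrow> ('k \<Rightarrow> 'l::ab_group_add \<Rightarrow> 'l) \<Rightarrow> nat \<Rightarrow>
   ('m list \<Rightarrow> 'l) \<Rightarrow> bool" where
  "multilinear sM sL n \<phi> \<longleftrightarrow>
     (\<forall>vs. length vs = n \<longrightarrow> (\<forall>i<n. Vector_Spaces.linear sM sL (\<lambda>x. \<phi> (vs[i := x])))) \<and>
     (\<forall>vs. length vs \<noteq> n \<longrightarrow> \<phi> vs = 0)"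

text \<open>\<open>cochains sM sL m\<close> are the \<open>(2m+1)\<close>-cochains; the symmetry conditions are void for \<open>m = 0\<close>.\<close>

definition cochains ::
  "('k::field \<Rightarrow> 'm::ab_group_add \<Rightarrow> 'm) \<Rightarrow> ('k \<Rightarrow> 'l::ab_group_add \<Rightarrow> 'l) \<Rightarrow> nat \<Rightarrow>
   ('m list \<Rightarrow> 'l) set" where
  "cochains sM sL m = {\<phi>. multilinear sM sL (2 * m + 1) \<phi> \<and>
     (m \<ge> 1 \<longrightarrow> (\<forall>vs. length vs = 2 * m - 2 \<longrightarrow>
        (\<forall>v u. \<phi> (vs @ [v, v, u]) = 0) \<and>
        (\<forall>x y z. \<phi> (vs @ [x, y, z]) + \<phi> (vs @ [y, z, x]) + \<phi> (vs @ [z, x, y]) = 0)))}"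

definition drop_pair :: "nat \<Rightarrow> 'a list \<Rightarrow> 'a list" where
  "drop_pair k vs = take (2 * k - 2) vs @ drop (2 * k) vs"

text \<open>
  \<open>coboundary sL br \<theta> H T m\<close> is the map from \<open>(2m-1)\<close>-cochains to \<open>(2m+1)\<close>-cochains, \<open>m \<ge> 1\<close>.
  \<open>drop_pair k\<close> omits the entries in positions \<open>2k-1\<close> and \<open>2k\<close>.
\<close>

definition coboundary ::
  "('k::field \<Rightarrow> 'l \<Rightarrow> 'l) \<Rightarrow> ('l \<Rightarrow> 'l \<Rightarrow> 'l \<Rightarrow> 'l::ab_group_add) \<Rightarrow>
   ('l \<Rightarrow> 'l \<Rightarrow> 'm \<Rightarrow> 'm::ab_group_add) \<Rightarrow> ('l \<Rightarrow> 'l \<Rightarrow> 'l \<Rightarrow> 'm) \<Rightarrow> ('m \<Rightarrow> 'l) \<Rightarrow> nat \<Rightarrow>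
   ('m list \<Rightarrow> 'l) \<Rightarrow> 'm list \<Rightarrow> 'l" where
  "coboundary sL br \<theta> H T m \<phi> = (\<lambda>vs.
     if length vs = 2 * m + 1 then
       (let v = (\<lambda>i. vs ! (i - 1));
            \<theta>T = theta_T br \<theta> H T;
            DT = rep_D \<theta>T;
            brT = bracket_T \<theta> H T
        in \<theta>T (v (2 * m)) (v (2 * m + 1)) (\<phi> (take (2 * m - 1) vs))
           - \<theta>T (v (2 * m - 1)) (v (2 * m + 1)) (\<phi> (take (2 * m - 2) vs @ [v (2 * m)]))
           + (\<Sum>k = 1..m. sL ((-1) ^ (m + k)) (DT (v (2 * k - 1)) (v (2 * k)) (\<phi> (drop_pair k vs))))
           + (\<Sum>k = 1..m. \<Sum>j = 2 * k + 1..2 * m + 1. sL ((-1) ^ (m + k + 1))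
                (\<phi> (drop_pair k (vs[j - 1 := brT (v (2 * k - 1)) (v (2 * k)) (v j)])))))
     else 0)"

definition cocycles where
  "cocycles sL br sM \<theta> H T m =
     {\<phi> \<in> cochains sM sL m. coboundary sL br \<theta> H T (m + 1) \<phi> = (\<lambda>_. 0)}"

definition coboundaries where
  "coboundaries sL br sM \<theta> H T m = coboundary sL br \<theta> H T m ` cochains sM sL (m - 1)"

text \<open>
  The quotient of \<open>cocycles\<close> by \<open>coboundaries\<close> in degree \<open>2m+1\<close>, \<open>m \<ge> 1\<close>, as a set of
  equivalence classes; \<open>\<H>\<^sup>3\<close> is the case \<open>m = 1\<close>. The zero element is the class of \<open>\<lambda>_. 0\<close>.
\<close>

definition cohomologous where
  "cohomologous sL br sM \<theta> H T m =
     {(\<phi>, \<psi>). \<phi> \<in> cocycles sL br sM \<theta> H T m \<and> \<psi> \<in> cocycles sL br sM \<theta> H T m \<and>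
        (\<lambda>vs. \<phi> vs - \<psi> vs) \<in> coboundaries sL br sM \<theta> H T m}"

definition cohomology where
  "cohomology sL br sM \<theta> H T m =
     cocycles sL br sM \<theta> H T m // cohomologous sL br sM \<theta> H T m"

definition cohomology_class where
  "cohomology_class sL br sM \<theta> H T m \<phi> = cohomologous sL br sM \<theta> H T m `` {\<phi>}"


section \<open>Deformations of finite order\<close>

text \<open>
  \<open>L[[\<lambda>]]\<close> is \<open>'l fps\<close>. Trilinear maps are extended \<open>\<lambda>\<close>-linearly, and \<open>deform n Ts\<close> is the
  \<open>\<lambda>\<close>-linear extension of \<open>\<Sum>i\<le>n. \<lambda>\<^sup>i T\<^sub>i\<close> to \<open>M[[\<lambda>]]\<close>; the maps \<open>Ts i\<close> with \<open>i > n\<close> are ignored.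
  Two series agree modulo \<open>\<lambda>\<^sup>n\<^sup>+\<^sup>1\<close> iff their images under \<open>fps_cutoff (n + 1)\<close> agree.
\<close>

definition fps_trilinear ::
  "('a \<Rightarrow> 'b \<Rightarrow> 'c \<Rightarrow> 'd::ab_group_add) \<Rightarrow>
   'a::zero fps \<Rightarrow> 'b::zero fps \<Rightarrow> 'c::zero fps \<Rightarrow> 'd fps" where
  "fps_trilinear f X Y Z =
     Abs_fps (\<lambda>p. \<Sum>(i, j, k)\<in>{(i, j, k). i + j + k = p}. f (fps_nth X i) (fps_nth Y j) (fps_nth Z k))"

definition deform ::
  "nat \<Rightarrow> (nat \<Rightarrow> 'm::zero \<Rightarrow> 'l::ab_group_add) \<Rightarrow> 'm fps \<Rightarrow> 'l fps" where
  "deform n Ts U = Abs_fps (\<lambda>p. \<Sum>(i, j)\<in>{(i, j). i \<le> n \<and> i + j = p}. Ts i (fps_nth U j))"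

definition order_deformation where
  "order_deformation sL br sM \<theta> H T n Ts \<longleftrightarrow>
     (\<forall>i\<le>n. Vector_Spaces.linear sM sL (Ts i)) \<and> Ts 0 = T \<and>
     (\<forall>u v w.
        let u' = fps_const u; v' = fps_const v; w' = fps_const w;
            x = deform n Ts u'; y = deform n Ts v'; z = deform n Ts w'
        in fps_cutoff (n + 1) (fps_trilinear br x y z)
           = fps_cutoff (n + 1) (deform n Ts
               (fps_trilinear (rep_D \<theta>) x y w' + fps_trilinear \<theta> y z u'
                - fps_trilinear \<theta> x z v' + fps_trilinear H x y z)))"

definition extendable where
  "extendable sL br sM \<theta> H T n Ts \<longleftrightarrow>
     (\<exists>T'. Vector_Spaces.linear sM sL T' \<and>
        order_deformation sL br sM \<theta> H T (n + 1) (Ts(n + 1 := T')))"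

definition cochain3 :: "('m \<Rightarrow> 'm \<Rightarrow> 'm \<Rightarrow> 'l::zero) \<Rightarrow> 'm list \<Rightarrow> 'l" where
  "cochain3 f vs = (case vs of [u, v, w] \<Rightarrow> f u v w | _ \<Rightarrow> 0)"

definition obstruction ::
  "('l \<Rightarrow> 'l \<Rightarrow> 'l \<Rightarrow> 'l::ab_group_add) \<Rightarrow> ('l \<Rightarrow> 'l \<Rightarrow> 'm \<Rightarrow> 'm::ab_group_add) \<Rightarrow>
   ('l \<Rightarrow> 'l \<Rightarrow> 'l \<Rightarrow> 'm) \<Rightarrow> nat \<Rightarrow> (nat \<Rightarrow> 'm \<Rightarrow> 'l) \<Rightarrow> 'm list \<Rightarrow> 'l" where
  "obstruction br \<theta> H n Ts = cochain3 (\<lambda>u v w.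
     (\<Sum>(i, j, k)\<in>{(i, j, k). i \<le> n \<and> j \<le> n \<and> k \<le> n \<and> i + j + k = n + 1}.
        br (Ts i u) (Ts j v) (Ts k w)
        - Ts i (rep_D \<theta> (Ts j u) (Ts k v) w + \<theta> (Ts j v) (Ts k w) u - \<theta> (Ts j u) (Ts k w) v))
     - (\<Sum>(i, j, k, l)\<in>{(i, j, k, l). i \<le> n \<and> j \<le> n \<and> k \<le> n \<and> l \<le> n \<and> i + j + k + l = n + 1}.
          Ts i (H (Ts j u) (Ts k v) (Ts l w))))"

end

theory Submission
  imports Defs "HOL-Library.Product_Plus"
begin

text \<open>
  For an arbitrary linear map \<open>S : M \<rightarrow> L\<close> put \<open>E\<^sub>S(u,v,w) = [Su,Sv,Sw] - S[u,v,w]\<^sub>S\<close>, so that \<open>S\<close> is a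
  generalized Reynolds operator iff \<open>E\<^sub>S = 0\<close>. The formulas for \<open>\<theta>\<^sub>S\<close>, \<open>D\<^sub>S\<close> and the coboundary make
  sense for every \<open>S\<close>, and the heart of the proof is the Bianchi identity \<open>\<delta>\<^sub>S E\<^sub>S = 0\<close>, valid for every
  linear \<open>S\<close> (lemma \<open>bianchi_identity\<close>). It holds because \<open>L \<oplus> M\<close> with the \<open>H\<close>-twisted semidirect
  bracket is a Lie triple system (\<open>semidirect_derivation\<close>). The projection \<open>p(x,u) = x - Su\<close> kills
  the graph of \<open>S\<close>, the map \<open>E\<^sub>S\<close> is \<open>p\<close> of the bracket of three graph elements, and \<open>\<theta>\<^sub>S\<close> and \<open>D\<^sub>S\<close> are
  \<open>p\<close> of a bracket of two graph elements with an element of \<open>L\<close>. Applying \<open>p\<close> to the derivation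
  identity for five graph elements gives the Bianchi identity.

  To apply this to a deformation, the formal parameter is specialised to scalars \<open>t\<close> of the
  infinite field. Then \<open>S\<^sub>t = \<Sum>\<^sub>i t\<^sup>i T\<^sub>i\<close> is an ordinary linear map, and \<open>E\<close> of it is a polynomial in \<open>t\<close>
  whose coefficients are those of the deformation equation (\<open>reynolds_defect_power_family\<close>). The
  coefficients of degree at most \<open>n\<close> vanish, so \<open>E = t\<^sup>n\<^sup>+\<^sup>1 R\<^sub>t\<close> with \<open>R\<^sub>t\<close> polynomial in \<open>t\<close> and
  \<open>R\<^sub>0 = Obs\<close>. For \<open>t \<noteq> 0\<close> the map \<open>R\<^sub>t\<close> inherits from \<open>E\<close> trilinearity, the two symmetries and the
  vanishing of its coboundary with respect to \<open>S\<^sub>t\<close>. These are polynomial identities in \<open>t\<close>, hence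
  they persist at \<open>t = 0\<close> (\<open>polynomial_map_eq_zero_at_zero\<close>), where they say that \<open>Obs\<close> is a
  3-cocycle for \<open>S\<^sub>0 = T\<close> (\<open>leading_defect_cocycle\<close>).

  Finally, adding \<open>\<lambda>\<^sup>n\<^sup>+\<^sup>1 f\<close> to the deformation leaves the coefficients of degree at most \<open>n\<close> of the
  deformation equation alone and adds \<open>\<delta>\<^sub>T f\<close> to the coefficient of degree \<open>n + 1\<close>
  (\<open>defect_coeff_extend\<close>). So \<open>f\<close> extends the deformation iff \<open>Obs = \<delta>\<^sub>T (-f)\<close>.
\<close>

section \<open>Linear and trilinear maps\<close>

lemma linear_simps:
  assumes "Vector_Spaces.linear s1 s2 f"
  shows "f (x + y) = f x + f y" "f (x - y) = f x - f y" "f (- x) = - f x" "f 0 = 0"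
    "f (s1 c x) = s2 c (f x)" "f (sum g I) = (\<Sum>i\<in>I. f (g i))"
proof -
  interpret Vector_Spaces.linear s1 s2 f by fact
  show "f (x + y) = f x + f y" "f (x - y) = f x - f y" "f (- x) = - f x" "f 0 = 0"
    "f (s1 c x) = s2 c (f x)" "f (sum g I) = (\<Sum>i\<in>I. f (g i))"
    by (simp_all add: add diff neg scale sum)
qed

lemma trilinear_linear:
  assumes "trilinear s1 s2 s3 s f"
  shows "Vector_Spaces.linear s1 s (\<lambda>x. f x y z)" "Vector_Spaces.linear s2 s (\<lambda>y. f x y z)"
    "Vector_Spaces.linear s3 s (\<lambda>z. f x y z)"
  using assms by (auto simp: trilinear_def)

lemmas trilinear_simps =
  linear_simps[OF trilinear_linear(1)] linear_simps[OF trilinear_linear(2)]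
  linear_simps[OF trilinear_linear(3)]

lemma trilinear_rep_D:
  assumes "trilinear s s t t \<theta>"
  shows "trilinear s s t t (rep_D \<theta>)"
proof -
  have "vector_space s" "vector_space t"
    using trilinear_linear(1)[OF assms] by (simp_all add: Vector_Spaces.linear_iff)
  then show ?thesis
    unfolding trilinear_def Vector_Spaces.linear_iff rep_D_def
    by (simp add: trilinear_simps[OF assms] module.scale_right_diff_distrib module_iff_vector_space)
qed

lemma bilinear_expand:
  assumes "\<And>y. Vector_Spaces.linear s1 s (\<lambda>x. g x y)" "\<And>x. Vector_Spaces.linear s2 s (g x)"
  shows "g (\<Sum>i\<in>I. s1 (x i) (a i)) (\<Sum>j\<in>J. s2 (y j) (b j))
           = (\<Sum>i\<in>I. \<Sum>j\<in>J. s (x i * y j) (g (a i) (b j)))"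
proof -
  interpret vector_space s using assms(1) by (simp add: Vector_Spaces.linear_iff)
  have "g (\<Sum>i\<in>I. s1 (x i) (a i)) (\<Sum>j\<in>J. s2 (y j) (b j))
      = (\<Sum>i\<in>I. s (x i) (g (a i) (\<Sum>j\<in>J. s2 (y j) (b j))))"
    by (simp add: linear_simps[OF assms(1)])
  then show ?thesis by (simp add: linear_simps[OF assms(2)] scale_sum_right)
qed

lemma alternating_imp_skew:
  fixes f :: "'a::ab_group_add \<Rightarrow> 'a \<Rightarrow> 'b::ab_group_add"
  assumes "\<And>x. f x x = 0" "\<And>x y z. f (x + y) z = f x z + f y z" "\<And>x y z. f x (y + z) = f x y + f x z"
  shows "f x y = - f y x"
proof -
  have "f x y + f y x = f (x + y) (x + y)"
    by (simp only: assms(2,3)) (simp add: assms(1))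
  then show ?thesis by (simp add: assms(1) eq_neg_iff_add_eq_0)
qed

section \<open>Polynomial maps into a vector space\<close>

text \<open>
  Generating polynomial maps by monomials and sums, instead of fixing a degree and a list of
  coefficients, makes the closure properties below direct inductions.
\<close>

inductive polynomial_map ::
  "('k::field \<Rightarrow> 'v::ab_group_add \<Rightarrow> 'v) \<Rightarrow> ('k \<Rightarrow> 'v) \<Rightarrow> bool" for s where
  monomial: "polynomial_map s (\<lambda>t. s (t ^ p) c)"
| add: "polynomial_map s f \<Longrightarrow> polynomial_map s g \<Longrightarrow> polynomial_map s (\<lambda>t. f t + g t)"

context vector_space
begin

lemma polynomial_map_const: "polynomial_map scale (\<lambda>_. c)"
  using polynomial_map.monomial[of scale 0 c] by simp

lemma polynomial_map_scale_power:
  "polynomial_map scale f \<Longrightarrow> polynomial_map scale (\<lambda>t. scale (t ^ q) (f t))"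
proof (induction rule: polynomial_map.induct)
  case (monomial p c)
  show ?case using polynomial_map.monomial[of scale "q + p" c] by (simp add: power_add)
next
  case (add f g)
  then show ?case using polynomial_map.add by (simp add: scale_right_distrib)
qed

lemma polynomial_map_sum:
  "(\<And>i. i \<in> I \<Longrightarrow> polynomial_map scale (f i)) \<Longrightarrow> polynomial_map scale (\<lambda>t. \<Sum>i\<in>I. f i t)"
  by (induction I rule: infinite_finite_induct)
     (auto intro: polynomial_map_const polynomial_map.add)

text \<open>
  A family of linear maps that is polynomial on each fixed vector stays polynomial on a vector
  that moves polynomially: expand the vector in powers of \<open>t\<close> and use linearity for each \<open>t\<close>. The
  closure properties that follow come from this one.
\<close>

lemma polynomial_map_apply:
  assumes lin: "\<And>t. Vector_Spaces.linear s scale (F t)"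
    and coeff: "\<And>c. polynomial_map scale (\<lambda>t. F t c)"
    and f: "polynomial_map s f"
  shows "polynomial_map scale (\<lambda>t. F t (f t))"
  using f
proof (induction rule: polynomial_map.induct)
  case (monomial p c)
  show ?case using polynomial_map_scale_power[OF coeff] lin by (simp add: Vector_Spaces.linear_iff)
next
  case (add f g)
  then show ?case using polynomial_map.add lin by (simp add: Vector_Spaces.linear_iff)
qed

lemma polynomial_map_minus:
  assumes "polynomial_map scale f"
  shows "polynomial_map scale (\<lambda>t. - f t)"
  using polynomial_map_apply[of scale "\<lambda>_. uminus" f] polynomial_map_const assms
  by (simp add: Vector_Spaces.linear_iff vector_space_axioms)

lemma polynomial_map_diff:
  assumes "polynomial_map scale f" "polynomial_map scale g"
  shows "polynomial_map scale (\<lambda>t. f t - g t)"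
  using polynomial_map.add[OF assms(1) polynomial_map_minus[OF assms(2)]] by simp

lemma polynomial_map_trilinear:
  assumes "\<And>t. trilinear s1 s2 s3 scale (F t)" "\<And>x y z. polynomial_map scale (\<lambda>t. F t x y z)"
    and "polynomial_map s1 f" "polynomial_map s2 g" "polynomial_map s3 h"
  shows "polynomial_map scale (\<lambda>t. F t (f t) (g t) (h t))"
proof -
  have 3: "polynomial_map scale (\<lambda>t. F t x y (h t))" for x y
    using trilinear_linear(3)[OF assms(1)] assms(2,5) by (rule polynomial_map_apply)
  have 2: "polynomial_map scale (\<lambda>t. F t x (g t) (h t))" for x
    using trilinear_linear(2)[OF assms(1)] 3 assms(4) by (rule polynomial_map_apply)
  show ?thesis
    using trilinear_linear(1)[OF assms(1)] 2 assms(3) by (rule polynomial_map_apply)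
qed

lemma polynomial_map_expansion:
  assumes "polynomial_map scale f"
  shows "\<exists>a N. \<forall>M\<ge>N. \<forall>t. f t = (\<Sum>p\<le>M. scale (t ^ p) (a p))"
  using assms
proof (induction rule: polynomial_map.induct)
  case (monomial p c)
  have "scale (t ^ p) c = (\<Sum>q\<le>M. scale (t ^ q) (if q = p then c else 0))" if "p \<le> M" for M t
  proof -
    have "(\<Sum>q\<le>M. scale (t ^ q) (if q = p then c else 0))
        = (\<Sum>q\<le>M. if q = p then scale (t ^ p) c else 0)"
      by (intro sum.cong) auto
    then show ?thesis using that by (simp add: sum.delta)
  qed
  then show ?case by metis
next
  case (add f g)
  then obtain a N b K where "\<forall>M\<ge>N. \<forall>t. f t = (\<Sum>p\<le>M. scale (t ^ p) (a p))"
    and "\<forall>M\<ge>K. \<forall>t. g t = (\<Sum>p\<le>M. scale (t ^ p) (b p))" by blast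
  then have "\<forall>M\<ge>max N K. \<forall>t. f t + g t = (\<Sum>p\<le>M. scale (t ^ p) (a p + b p))"
    by (auto simp: scale_right_distrib sum.distrib)
  then show ?case by (intro exI[of _ "\<lambda>p. a p + b p"] exI[of _ "max N K"])
qed

end

text \<open>
  Counting roots does not apply to coefficients in a vector space. Instead, if \<open>P\<close> has degree at most
  \<open>N + 1\<close> and vanishes off \<open>0\<close>, then so does \<open>P(2t) - 2\<^sup>N\<^sup>+\<^sup>1 P(t)\<close>, which has degree at most \<open>N\<close>. Its
  coefficients are those of \<open>P\<close> times \<open>2\<^sup>p - 2\<^sup>N\<^sup>+\<^sup>1\<close>, and these factors are nonzero in characteristic
  \<open>0\<close>.
\<close>

lemma polynomial_coeffs_eq_zero:
  fixes s :: "'k::field_char_0 \<Rightarrow> 'v::ab_group_add \<Rightarrow> 'v"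
  assumes "vector_space s"
    and "\<And>t. t \<noteq> 0 \<Longrightarrow> (\<Sum>p\<le>N. s (t ^ p) (a p)) = 0"
    and "p \<le> N"
  shows "a p = 0"
  using assms(2,3)
proof (induction N arbitrary: a p)
  case 0
  interpret vector_space s by fact
  show ?case using 0(1)[of 1] 0(2) by simp
next
  case (Suc N)
  interpret vector_space s by fact
  have low: "a q = 0" if "q \<le> N" for q
  proof -
    have "s (2 ^ q - 2 ^ Suc N) (a q) = 0"
    proof (rule Suc.IH[OF _ that])
      fix t :: 'k
      assume t: "t \<noteq> 0"
      let ?P = "\<lambda>t. \<Sum>p\<le>Suc N. s (t ^ p) (a p)"
      have "0 = ?P (2 * t) - s (2 ^ Suc N) (?P t)"
        using Suc.prems(1)[of t] Suc.prems(1)[of "2 * t"] t by simp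
      also have "\<dots> = (\<Sum>p\<le>Suc N. s (t ^ p) (s (2 ^ p - 2 ^ Suc N) (a p)))"
        by (simp only: scale_sum_right flip: sum_subtractf)
           (simp add: power_mult_distrib scale_left_diff_distrib scale_right_diff_distrib
                      mult.commute mult.left_commute)
      also have "\<dots> = (\<Sum>p\<le>N. s (t ^ p) (s (2 ^ p - 2 ^ Suc N) (a p)))" by simp
      finally show "(\<Sum>p\<le>N. s (t ^ p) (s (2 ^ p - 2 ^ Suc N) (a p))) = 0" by simp
    qed
    moreover have "(2::'k) ^ q \<noteq> 2 ^ Suc N"
    proof
      assume "(2::'k) ^ q = 2 ^ Suc N"
      then have "of_nat (2 ^ q) = (of_nat (2 ^ Suc N) :: 'k)" by simp
      then have "(2::nat) ^ q = 2 ^ Suc N" by (simp only: of_nat_eq_iff)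
      with that show False using power_inject_exp[of "2::nat" q "Suc N"] by simp
    qed
    ultimately show ?thesis by simp
  qed
  moreover have "a (Suc N) = 0"
    using Suc.prems(1)[of 1] low by simp
  ultimately show ?case using Suc.prems(2) by (cases "p = Suc N") auto
qed

text \<open>
  This replaces passing to the limit \<open>t \<rightarrow> 0\<close>: an identity that was divided by a power of \<open>t\<close> still
  holds at \<open>t = 0\<close>.
\<close>

lemma polynomial_map_eq_zero_at_zero:
  fixes s :: "'k::field_char_0 \<Rightarrow> 'v::ab_group_add \<Rightarrow> 'v"
  assumes "vector_space s" "polynomial_map s f" "\<And>t. t \<noteq> 0 \<Longrightarrow> f t = 0"
  shows "f 0 = 0"
proof -
  interpret vector_space s by fact
  obtain a N where aN: "\<And>t. f t = (\<Sum>p\<le>N. s (t ^ p) (a p))"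
    using polynomial_map_expansion[OF assms(2)] by blast
  have "a p = 0" if "p \<le> N" for p
    using polynomial_coeffs_eq_zero[OF assms(1) _ that] assms(3) aN by metis
  then show ?thesis by (simp add: aN)
qed

section \<open>Sums over index tuples of given total degree\<close>

lemma finite_triples: "finite {(i, j, k). i + j + k = (p::nat)}"
  by (rule finite_subset[of _ "{..p} \<times> {..p} \<times> {..p}"]) auto

lemma finite_quadruples: "finite {(i, j, k, l). i + j + k + l = (p::nat)}"
  by (rule finite_subset[of _ "{..p} \<times> {..p} \<times> {..p} \<times> {..p}"]) auto

text \<open>
  In a tuple of total \<open>n + 1\<close>, either all entries are at most \<open>n\<close>, or one of them is \<open>n + 1\<close> and
  the others are \<open>0\<close>. The first kind makes up the obstruction; in the second kind the new map of
  an extension enters, in the place of the entry \<open>n + 1\<close>.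
\<close>

lemma sum_triples_split_top:
  fixes f :: "nat \<Rightarrow> nat \<Rightarrow> nat \<Rightarrow> 'a::ab_group_add"
  shows "(\<Sum>(i, j, k)\<in>{(i, j, k). i + j + k = n + 1}. f i j k)
     = (\<Sum>(i, j, k)\<in>{(i, j, k). i \<le> n \<and> j \<le> n \<and> k \<le> n \<and> i + j + k = n + 1}. f i j k)
       + (f (n + 1) 0 0 + f 0 (n + 1) 0 + f 0 0 (n + 1))"
proof -
  let ?A = "{(i, j, k). i + j + k = n + 1}"
  let ?B = "{(i, j, k). i \<le> n \<and> j \<le> n \<and> k \<le> n \<and> i + j + k = n + 1}"
  let ?X = "{(n + 1, 0, 0), (0, n + 1, 0), (0, 0, n + 1)}"
  let ?f = "\<lambda>(i, j, k). f i j k"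
  have "(i, j, k) \<in> ?B \<union> ?X" if "i + j + k = n + 1" for i j k
  proof -
    consider "i \<le> n \<and> j \<le> n \<and> k \<le> n" | "n < i" | "n < j" | "n < k" by linarith
    then show ?thesis using that by cases auto
  qed
  then have A: "?A = ?B \<union> ?X" by auto
  have "finite ?B"
    by (rule finite_subset[OF _ finite_triples[of "n + 1"]]) auto
  moreover have "?B \<inter> ?X = {}" by simp
  ultimately have "sum ?f ?A = sum ?f ?B + sum ?f ?X"
    unfolding A by (intro sum.union_disjoint) simp_all
  also have "sum ?f ?X = f (n + 1) 0 0 + f 0 (n + 1) 0 + f 0 0 (n + 1)"
    by simp
  finally show ?thesis .
qed

lemma sum_quadruples_split_top:
  fixes f :: "nat \<Rightarrow> nat \<Rightarrow> nat \<Rightarrow> nat \<Rightarrow> 'a::ab_group_add"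
  shows "(\<Sum>(i, j, k, l)\<in>{(i, j, k, l). i + j + k + l = n + 1}. f i j k l)
     = (\<Sum>(i, j, k, l)\<in>{(i, j, k, l). i \<le> n \<and> j \<le> n \<and> k \<le> n \<and> l \<le> n \<and> i + j + k + l = n + 1}.
          f i j k l)
       + (f (n + 1) 0 0 0 + f 0 (n + 1) 0 0 + f 0 0 (n + 1) 0 + f 0 0 0 (n + 1))"
proof -
  let ?A = "{(i, j, k, l). i + j + k + l = n + 1}"
  let ?B = "{(i, j, k, l). i \<le> n \<and> j \<le> n \<and> k \<le> n \<and> l \<le> n \<and> i + j + k + l = n + 1}"
  let ?X = "{(n + 1, 0, 0, 0), (0, n + 1, 0, 0), (0, 0, n + 1, 0), (0, 0, 0, n + 1)}"
  let ?f = "\<lambda>(i, j, k, l). f i j k l"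
  have top: "(i, j, k, l) \<in> ?X"
    if deg: "i + j + k + l = n + 1" and large: "\<not> (i \<le> n \<and> j \<le> n \<and> k \<le> n \<and> l \<le> n)"
    for i j k l
  proof -
    consider "n < i" | "n < j" | "n < k" | "n < l" using large by linarith
    then show ?thesis using deg by cases auto
  qed
  have A: "?A = ?B \<union> ?X"
  proof
    show "?A \<subseteq> ?B \<union> ?X"
    proof (clarify del: UnCI)
      fix i j k l assume "i + j + k + l = n + 1"
      then show "(i, j, k, l) \<in> ?B \<union> ?X" using top[of i j k l] by blast
    qed
    have "?B \<subseteq> ?A" by blast
    moreover have "?X \<subseteq> ?A" by simp
    ultimately show "?B \<union> ?X \<subseteq> ?A" by (rule Un_least)
  qed
  have "finite ?B"
    by (rule finite_subset[OF _ finite_quadruples[of "n + 1"]]) auto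
  moreover have "?B \<inter> ?X = {}" by simp
  ultimately have "sum ?f ?A = sum ?f ?B + sum ?f ?X"
    unfolding A by (intro sum.union_disjoint) simp_all
  also have "sum ?f ?X = f (n + 1) 0 0 0 + f 0 (n + 1) 0 0 + f 0 0 (n + 1) 0 + f 0 0 0 (n + 1)"
    by simp
  finally show ?thesis .
qed

text \<open>
  The left-hand side is the shape of a coefficient of \<open>deform n Ts\<close> applied to a series; in degrees
  up to \<open>n\<close> its bound \<open>i \<le> n\<close> holds automatically.
\<close>

lemma sum_nested_triples:
  fixes f :: "nat \<Rightarrow> nat \<Rightarrow> nat \<Rightarrow> 'a::ab_group_add"
  assumes "p \<le> n"
  shows "(\<Sum>(i, q)\<in>{(i, q). i \<le> n \<and> i + q = p}. \<Sum>(j, k)\<in>{(j, k). j + k = q}. f i j k)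
     = (\<Sum>(i, j, k)\<in>{(i, j, k). i + j + k = p}. f i j k)"
proof -
  have "finite {(j, k). j + k = q}" for q :: nat
    by (rule finite_subset[of _ "{..q} \<times> {..q}"]) auto
  moreover have "finite {(i, q). i \<le> n \<and> i + q = p}"
    by (rule finite_subset[of _ "{..p} \<times> {..p}"]) auto
  ultimately have "(\<Sum>(i, q)\<in>{(i, q). i \<le> n \<and> i + q = p}. \<Sum>(j, k)\<in>{(j, k). j + k = q}. f i j k)
      = (\<Sum>((i, q), (j, k))\<in>(SIGMA (i, q):{(i, q). i \<le> n \<and> i + q = p}. {(j, k). j + k = q}). f i j k)"
    by (simp add: split_def sum.Sigma)
  also have "\<dots> = (\<Sum>(i, j, k)\<in>{(i, j, k). i + j + k = p}. f i j k)"
    using assms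
    by (intro sum.reindex_bij_witness[of _ "\<lambda>(i, j, k). ((i, j + k), (j, k))" "\<lambda>((i, q), (j, k)). (i, j, k)"]) auto
  finally show ?thesis .
qed

lemma sum_nested_quadruples:
  fixes f :: "nat \<Rightarrow> nat \<Rightarrow> nat \<Rightarrow> nat \<Rightarrow> 'a::ab_group_add"
  assumes "p \<le> n"
  shows "(\<Sum>(i, q)\<in>{(i, q). i \<le> n \<and> i + q = p}. \<Sum>(j, k, l)\<in>{(j, k, l). j + k + l = q}. f i j k l)
     = (\<Sum>(i, j, k, l)\<in>{(i, j, k, l). i + j + k + l = p}. f i j k l)"
proof -
  have "finite {(i, q). i \<le> n \<and> i + q = p}"
    by (rule finite_subset[of _ "{..p} \<times> {..p}"]) auto
  then have "(\<Sum>(i, q)\<in>{(i, q). i \<le> n \<and> i + q = p}. \<Sum>(j, k, l)\<in>{(j, k, l). j + k + l = q}. f i j k l)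
      = (\<Sum>((i, q), (j, k, l))\<in>(SIGMA (i, q):{(i, q). i \<le> n \<and> i + q = p}. {(j, k, l). j + k + l = q}). f i j k l)"
    using finite_triples by (simp add: split_def sum.Sigma)
  also have "\<dots> = (\<Sum>(i, j, k, l)\<in>{(i, j, k, l). i + j + k + l = p}. f i j k l)"
    using assms
    by (intro sum.reindex_bij_witness[of _ "\<lambda>(i, j, k, l). ((i, j + k + l), (j, k, l))"
          "\<lambda>((i, q), (j, k, l)). (i, j, k, l)"]) auto
  finally show ?thesis .
qed

lemma (in vector_space) sum_collect_by_degree:
  fixes t :: 'a
  assumes "finite B" "\<And>x. x \<in> B \<Longrightarrow> deg x \<le> N" "\<And>x. x \<notin> B \<Longrightarrow> f x = 0"
    and "\<And>p. finite {x. deg x = p}"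
  shows "(\<Sum>x\<in>B. scale (t ^ deg x) (f x)) = (\<Sum>p\<le>N. scale (t ^ p) (\<Sum>x | deg x = p. f x))"
proof -
  have "(\<Sum>x\<in>B. scale (t ^ deg x) (f x))
      = (\<Sum>p\<le>N. \<Sum>x | x \<in> B \<and> deg x = p. scale (t ^ deg x) (f x))"
    using assms(1,2) by (intro sum.group[symmetric]) auto
  also have "\<dots> = (\<Sum>p\<le>N. scale (t ^ p) (\<Sum>x | deg x = p. f x))"
  proof (intro sum.cong refl)
    fix p
    have "(\<Sum>x | x \<in> B \<and> deg x = p. scale (t ^ deg x) (f x))
        = scale (t ^ p) (\<Sum>x | x \<in> B \<and> deg x = p. f x)"
      by (simp add: scale_sum_right)
    also have "(\<Sum>x | x \<in> B \<and> deg x = p. f x) = (\<Sum>x | deg x = p. f x)"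
      using assms(3,4) by (intro sum.mono_neutral_left) auto
    finally show "(\<Sum>x | x \<in> B \<and> deg x = p. scale (t ^ deg x) (f x))
        = scale (t ^ p) (\<Sum>x | deg x = p. f x)" .
  qed
  finally show ?thesis .
qed

section \<open>The twisted semidirect product\<close>

context lts_3_cocycle
begin

lemmas br_simps = trilinear_simps[OF br_trilinear]

lemmas rep_simps = trilinear_simps[OF rep_trilinear]

lemmas D_simps = trilinear_simps[OF trilinear_rep_D[OF rep_trilinear]]

lemmas H_simps = trilinear_simps[OF H_trilinear]

text \<open>
  The triple bracket of the extension of \<open>L\<close> by the abelian ideal \<open>M\<close> with action \<open>\<theta>\<close> and cocycle
  \<open>H\<close>. The lemmas below are the identities of a Lie triple system for it.
\<close>

definition semidirect :: "'l \<times> 'm \<Rightarrow> 'l \<times> 'm \<Rightarrow> 'l \<times> 'm \<Rightarrow> 'l \<times> 'm" where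
  "semidirect a b c =
     (br (fst a) (fst b) (fst c),
      rep_D \<theta> (fst a) (fst b) (snd c) + \<theta> (fst b) (fst c) (snd a) - \<theta> (fst a) (fst c) (snd b)
        + H (fst a) (fst b) (fst c))"

lemma semidirect_add:
  "semidirect (a + a') b c = semidirect a b c + semidirect a' b c"
  "semidirect a (b + b') c = semidirect a b c + semidirect a b' c"
  "semidirect a b (c + c') = semidirect a b c + semidirect a b c'"
  by (simp_all add: semidirect_def br_simps rep_simps D_simps H_simps)

lemma semidirect_alt: "semidirect a a b = 0"
  by (simp add: semidirect_def br_alt H_alt rep_D_def zero_prod_def)

lemma semidirect_skew: "semidirect a b c = - semidirect b a c"
  by (rule alternating_imp_skew[of "\<lambda>x y. semidirect x y c"])
     (simp_all add: semidirect_alt semidirect_add)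

lemma semidirect_cyclic: "semidirect a b c + semidirect b c a + semidirect c a b = 0"
  using H_cyclic[of "fst a" "fst b" "fst c"] br_cyclic[of "fst a" "fst b" "fst c"]
  by (simp add: semidirect_def rep_D_def zero_prod_def add.assoc)

text \<open>
  In the component \<open>M\<close> both sides are compared separately in each \<open>u\<^sub>i\<close> and in the terms with \<open>H\<close>:
  the terms in \<open>u\<^sub>1\<close> and \<open>u\<^sub>2\<close> agree by the first axiom of a representation, those in \<open>u\<^sub>3\<close>,
  \<open>u\<^sub>4\<close> and \<open>u\<^sub>5\<close> by the second one, and those with \<open>H\<close> by the cocycle condition.
\<close>

lemma semidirect_derivation:
  "semidirect a b (semidirect c d e) =
     semidirect (semidirect a b c) d e + semidirect c (semidirect a b d) e
       + semidirect c d (semidirect a b e)"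
proof (cases a; cases b; cases c; cases d; cases e)
  fix x1 x2 x3 x4 x5 u1 u2 u3 u4 u5
  assume e: "a = (x1, u1)" "b = (x2, u2)" "c = (x3, u3)" "d = (x4, u4)" "e = (x5, u5)"
  \<comment> \<open>Oriented as rewrite rules that move the action of \<open>(x1, x2)\<close> inwards and remove outer brackets;
    both sides then reduce to the same sum.\<close>
  have r1: "\<theta> x (br x3 x4 x5) u
      = \<theta> x4 x5 (\<theta> x x3 u) - \<theta> x3 x5 (\<theta> x x4 u) + rep_D \<theta> x3 x4 (\<theta> x x5 u)" for x u
    using rep_1[of x4 x5 x x3 u] by (simp add: algebra_simps)
  have r2: "rep_D \<theta> x1 x2 (\<theta> z t u)
      = \<theta> z t (rep_D \<theta> x1 x2 u) + \<theta> (br x1 x2 z) t u + \<theta> z (br x1 x2 t) u" for z t u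
    using rep_2[of z t x1 x2 u] by (simp add: algebra_simps)
  have r3: "rep_D \<theta> x1 x2 (rep_D \<theta> z t u)
      = rep_D \<theta> z t (rep_D \<theta> x1 x2 u) + rep_D \<theta> (br x1 x2 z) t u + rep_D \<theta> z (br x1 x2 t) u"
    for z t u
    by (simp add: rep_D_def[of \<theta> z] rep_D_def[of \<theta> "br x1 x2 z"] D_simps r2 algebra_simps)
  have h: "rep_D \<theta> x1 x2 (H x3 x4 x5)
      = H x3 x4 (br x1 x2 x5) + \<theta> x4 x5 (H x1 x2 x3) - \<theta> x3 x5 (H x1 x2 x4)
        + rep_D \<theta> x3 x4 (H x1 x2 x5) + H (br x1 x2 x3) x4 x5 + H x3 (br x1 x2 x4) x5
        - H x1 x2 (br x3 x4 x5)"
    using H_cocycle[of x1 x2 x3 x4 x5] by (simp add: algebra_simps)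
  show ?thesis
    by (simp add: e semidirect_def br_derivation[of x1 x2] rep_simps D_simps H_simps r1 r2 r3 h)
qed

section \<open>The defect of a linear map and its Bianchi identity\<close>

definition graph :: "('m \<Rightarrow> 'l) \<Rightarrow> 'm \<Rightarrow> 'l \<times> 'm" where
  "graph S u = (S u, u)"

text \<open>
  The projection of \<open>L \<oplus> M\<close> to \<open>L\<close> along the graph of \<open>S\<close>.
\<close>

definition graph_proj :: "('m \<Rightarrow> 'l) \<Rightarrow> 'l \<times> 'm \<Rightarrow> 'l" where
  "graph_proj S a = fst a - S (snd a)"

text \<open>
  The failure of the graph of \<open>S\<close> to be a subsystem of the twisted semidirect product, that is, of
  \<open>S\<close> to be a generalized Reynolds operator.
\<close>

definition reynolds_defect :: "('m \<Rightarrow> 'l) \<Rightarrow> 'm \<Rightarrow> 'm \<Rightarrow> 'm \<Rightarrow> 'l" where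
  "reynolds_defect S u v w = graph_proj S (semidirect (graph S u) (graph S v) (graph S w))"

lemma reynolds_defect_eq:
  "reynolds_defect S u v w = br (S u) (S v) (S w) - S (bracket_T \<theta> H S u v w)"
  by (simp add: reynolds_defect_def graph_proj_def semidirect_def graph_def bracket_T_def
                algebra_simps)

lemma semidirect_graph:
  "semidirect (graph S u) (graph S v) (graph S w)
     = graph S (bracket_T \<theta> H S u v w) + (reynolds_defect S u v w, 0)"
  by (simp add: reynolds_defect_eq graph_def semidirect_def bracket_T_def algebra_simps)

lemma theta_T_eq_semidirect:
  "theta_T br \<theta> H S v w x = graph_proj S (semidirect (x, 0) (graph S v) (graph S w))"
  by (simp add: theta_T_def graph_proj_def semidirect_def graph_def rep_simps)

context
  fixes S :: "'m \<Rightarrow> 'l"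
  assumes S_linear: "Vector_Spaces.linear sM sL S"
begin

lemma graph_proj_simps:
  "graph_proj S (a + b) = graph_proj S a + graph_proj S b"
  "graph_proj S (a - b) = graph_proj S a - graph_proj S b"
  "graph_proj S (- a) = - graph_proj S a"
  "graph_proj S (graph S u) = 0"
  "graph_proj S (x, 0) = x"
  by (simp_all add: graph_proj_def graph_def linear_simps[OF S_linear])

text \<open>
  Together with the previous description of \<open>\<theta>\<^sub>S\<close>, this lemma and the next one express the bracket
  of two graph elements with an element of \<open>L\<close>, in any position, through \<open>\<theta>\<^sub>S\<close> and \<open>D\<^sub>S\<close>. These are
  the terms in which one entry of a bracket is a value of the defect.
\<close>

lemma neg_theta_T_eq_semidirect:
  "- theta_T br \<theta> H S u w x = graph_proj S (semidirect (graph S u) (x, 0) (graph S w))"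
  by (simp add: theta_T_eq_semidirect semidirect_skew[of "graph S u" "(x, 0)"] graph_proj_simps)

lemma D_T_eq_semidirect:
  "rep_D (theta_T br \<theta> H S) u v x = graph_proj S (semidirect (graph S u) (graph S v) (x, 0))"
proof -
  have "semidirect (graph S u) (graph S v) (x, 0)
      = semidirect (x, 0) (graph S v) (graph S u) - semidirect (x, 0) (graph S u) (graph S v)"
    using semidirect_cyclic[of "graph S u" "graph S v" "(x, 0)"]
      semidirect_skew[of "graph S v" "(x, 0)" "graph S u"]
    by (simp add: add_eq_0_iff algebra_simps)
  then show ?thesis by (simp add: rep_D_def theta_T_eq_semidirect graph_proj_simps)
qed

lemma theta_T_linear: "Vector_Spaces.linear sL sL (theta_T br \<theta> H S v w)"
  unfolding Vector_Spaces.linear_iff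
  by (simp add: vector_space_axioms theta_T_def br_simps rep_simps D_simps H_simps
      linear_simps[OF S_linear] scale_right_diff_distrib M.scale_right_diff_distrib
      scale_right_distrib M.scale_right_distrib algebra_simps)

lemma D_T_linear: "Vector_Spaces.linear sL sL (rep_D (theta_T br \<theta> H S) v w)"
  using theta_T_linear unfolding Vector_Spaces.linear_iff
  by (simp add: rep_D_def scale_right_diff_distrib algebra_simps)

lemma reynolds_defect_linear:
  "Vector_Spaces.linear sM sL (\<lambda>u. reynolds_defect S u v w)"
  "Vector_Spaces.linear sM sL (\<lambda>v. reynolds_defect S u v w)"
  "Vector_Spaces.linear sM sL (\<lambda>w. reynolds_defect S u v w)"
  unfolding Vector_Spaces.linear_iff
  by (simp_all add: vector_space_axioms M.vector_space_axioms reynolds_defect_eq bracket_T_def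
       br_simps rep_simps D_simps H_simps
      linear_simps[OF S_linear] scale_right_diff_distrib M.scale_right_diff_distrib
      scale_right_distrib M.scale_right_distrib algebra_simps)

lemma reynolds_defect_alt: "reynolds_defect S u u w = 0"
  by (simp add: reynolds_defect_def semidirect_alt graph_proj_def linear_simps[OF S_linear])

lemma reynolds_defect_cyclic:
  "reynolds_defect S u v w + reynolds_defect S v w u + reynolds_defect S w u v = 0"
  by (simp add: reynolds_defect_def semidirect_cyclic linear_simps[OF S_linear]
       graph_proj_def[of S 0] flip: graph_proj_simps)

end

text \<open>
  The coboundary of a 3-cochain, with cochains as functions of three arguments and not of lists, so
  that the identities are those of ordinary multilinear algebra.
\<close>

definition coboundary3 :: "('m \<Rightarrow> 'l) \<Rightarrow> ('m \<Rightarrow> 'm \<Rightarrow> 'm \<Rightarrow> 'l) \<Rightarrow> 'm \<Rightarrow> 'm \<Rightarrow> 'm \<Rightarrow> 'm \<Rightarrow> 'm \<Rightarrow> 'l" where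
  "coboundary3 S f v1 v2 v3 v4 v5 =
     theta_T br \<theta> H S v4 v5 (f v1 v2 v3) - theta_T br \<theta> H S v3 v5 (f v1 v2 v4)
     - rep_D (theta_T br \<theta> H S) v1 v2 (f v3 v4 v5) + rep_D (theta_T br \<theta> H S) v3 v4 (f v1 v2 v5)
     + f (bracket_T \<theta> H S v1 v2 v3) v4 v5 + f v3 (bracket_T \<theta> H S v1 v2 v4) v5
     + f v3 v4 (bracket_T \<theta> H S v1 v2 v5) - f v1 v2 (bracket_T \<theta> H S v3 v4 v5)"

text \<open>
  The bracket of three graph elements is a graph element plus a value of the defect in \<open>L\<close>. In the
  derivation identity for five graph elements, the inner graph parts therefore contribute values of
  the defect on a bracket \<open>[\<cdot>,\<cdot>,\<cdot>]\<^sub>S\<close>, and the inner defects contribute the terms with \<open>\<theta>\<^sub>S\<close> and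
  \<open>D\<^sub>S\<close>. Each inner bracket occurs in one slot only, so there are no terms quadratic in the defect.
\<close>

lemma bianchi_identity:
  assumes S: "Vector_Spaces.linear sM sL S"
  shows "coboundary3 S (reynolds_defect S) v1 v2 v3 v4 v5 = 0"
proof -
  define g where "g = graph S"
  define p where "p = graph_proj S"
  have p0: "p 0 = 0" by (simp add: p_def graph_proj_def linear_simps[OF S])
  have "p (semidirect (g v1) (g v2) (semidirect (g v3) (g v4) (g v5))
         - (semidirect (semidirect (g v1) (g v2) (g v3)) (g v4) (g v5)
            + semidirect (g v3) (semidirect (g v1) (g v2) (g v4)) (g v5)
            + semidirect (g v3) (g v4) (semidirect (g v1) (g v2) (g v5)))) = 0"
    by (simp add: semidirect_derivation[of "g v1" "g v2" "g v3"] p0)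
  then show ?thesis
    by (simp add: g_def p_def semidirect_graph semidirect_add graph_proj_simps[OF S]
         D_T_eq_semidirect[OF S, symmetric] neg_theta_T_eq_semidirect[OF S, symmetric] coboundary3_def
         theta_T_eq_semidirect[symmetric] algebra_simps
         flip: reynolds_defect_def)
qed

section \<open>The defect of a polynomial family of linear maps\<close>

definition defect_term3 :: "(nat \<Rightarrow> 'm \<Rightarrow> 'l) \<Rightarrow> 'm \<Rightarrow> 'm \<Rightarrow> 'm \<Rightarrow> nat \<Rightarrow> nat \<Rightarrow> nat \<Rightarrow> 'l" where
  "defect_term3 U u v w i j k = br (U i u) (U j v) (U k w)
     - U i (rep_D \<theta> (U j u) (U k v) w + \<theta> (U j v) (U k w) u - \<theta> (U j u) (U k w) v)"

definition defect_term4 ::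
  "(nat \<Rightarrow> 'm \<Rightarrow> 'l) \<Rightarrow> 'm \<Rightarrow> 'm \<Rightarrow> 'm \<Rightarrow> nat \<Rightarrow> nat \<Rightarrow> nat \<Rightarrow> nat \<Rightarrow> 'l" where
  "defect_term4 U u v w i j k l = U i (H (U j u) (U k v) (U l w))"

text \<open>
  The coefficient of \<open>\<lambda>\<^sup>p\<close> in the deformation equation for \<open>\<Sum>\<^sub>i \<lambda>\<^sup>i U\<^sub>i\<close>.
\<close>

definition defect_coeff :: "(nat \<Rightarrow> 'm \<Rightarrow> 'l) \<Rightarrow> nat \<Rightarrow> 'm \<Rightarrow> 'm \<Rightarrow> 'm \<Rightarrow> 'l" where
  "defect_coeff U p u v w =
     (\<Sum>(i, j, k)\<in>{(i, j, k). i + j + k = p}. defect_term3 U u v w i j k)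
     - (\<Sum>(i, j, k, l)\<in>{(i, j, k, l). i + j + k + l = p}. defect_term4 U u v w i j k l)"

definition power_family :: "nat \<Rightarrow> (nat \<Rightarrow> 'm \<Rightarrow> 'l) \<Rightarrow> 'k \<Rightarrow> 'm \<Rightarrow> 'l" where
  "power_family n U t u = (\<Sum>i\<le>n. sL (t ^ i) (U i u))"

lemma power_family_linear:
  assumes "\<And>i. Vector_Spaces.linear sM sL (U i)"
  shows "Vector_Spaces.linear sM sL (power_family n U t)"
  unfolding Vector_Spaces.linear_iff
  by (simp add: vector_space_axioms M.vector_space_axioms power_family_def linear_simps[OF assms]
        scale_right_distrib sum.distrib scale_sum_right mult.commute)

text \<open>
  The degree bound \<open>4 n\<close> comes from the term \<open>S(H(Su,Sv,Sw))\<close>, which is of degree four in \<open>S\<close>.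
\<close>

lemma reynolds_defect_power_family:
  assumes lin: "\<And>i. Vector_Spaces.linear sM sL (U i)"
    and zero: "\<And>i. i > n \<Longrightarrow> U i = (\<lambda>_. 0)"
    and N: "4 * n \<le> N"
  shows "reynolds_defect (power_family n U t) u v w
           = (\<Sum>p\<le>N. sL (t ^ p) (defect_coeff U p u v w))"
proof -
  let ?S = "power_family n U t"
  let ?P = "\<lambda>j k. rep_D \<theta> (U j u) (U k v) w + \<theta> (U j v) (U k w) u - \<theta> (U j u) (U k w) v"
  let ?B3 = "{..n} \<times> {..n} \<times> {..n}" and ?B4 = "{..n} \<times> {..n} \<times> {..n} \<times> {..n}"
  note lins = br_trilinear[THEN trilinear_linear(1)] br_trilinear[THEN trilinear_linear(2)]
    rep_trilinear[THEN trilinear_linear(1)] rep_trilinear[THEN trilinear_linear(2)]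
    H_trilinear[THEN trilinear_linear(1)] H_trilinear[THEN trilinear_linear(2)]
    trilinear_rep_D[OF rep_trilinear, THEN trilinear_linear(1)]
    trilinear_rep_D[OF rep_trilinear, THEN trilinear_linear(2)]
  have b': "br (?S u) (?S v) z = (\<Sum>i\<le>n. \<Sum>j\<le>n. sL (t ^ i * t ^ j) (br (U i u) (U j v) z))" for z
    unfolding power_family_def
    by (rule bilinear_expand[of sL sL "\<lambda>x y. br x y z" sL], simp_all add: lins)
  have b: "br (?S u) (?S v) (?S w)
      = (\<Sum>i\<le>n. \<Sum>j\<le>n. \<Sum>k\<le>n. sL (t ^ (i + j + k)) (br (U i u) (U j v) (U k w)))"
    unfolding b' by (simp add: power_family_def br_simps scale_sum_right power_add)
  have h': "H (?S u) (?S v) z = (\<Sum>i\<le>n. \<Sum>j\<le>n. sM (t ^ i * t ^ j) (H (U i u) (U j v) z))" for z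
    unfolding power_family_def
    by (rule bilinear_expand[of sL sM "\<lambda>x y. H x y z" sL], simp_all add: lins)
  have h: "H (?S u) (?S v) (?S w)
      = (\<Sum>i\<le>n. \<Sum>j\<le>n. \<Sum>k\<le>n. sM (t ^ (i + j + k)) (H (U i u) (U j v) (U k w)))"
    unfolding h' by (simp add: power_family_def H_simps M.scale_sum_right power_add)
  have d: "rep_D \<theta> (?S x) (?S y) z = (\<Sum>j\<le>n. \<Sum>k\<le>n. sM (t ^ (j + k)) (rep_D \<theta> (U j x) (U k y) z))"
    and th: "\<theta> (?S x) (?S y) z = (\<Sum>j\<le>n. \<Sum>k\<le>n. sM (t ^ (j + k)) (\<theta> (U j x) (U k y) z))" for x y z
    unfolding power_family_def power_add
    by (rule bilinear_expand[of sL sM "\<lambda>x y. rep_D \<theta> x y _" sL], simp_all add: lins)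
       (rule bilinear_expand[of sL sM "\<lambda>x y. \<theta> x y _" sL], simp_all add: lins)
  have "rep_D \<theta> (?S u) (?S v) w + \<theta> (?S v) (?S w) u - \<theta> (?S u) (?S w) v
      = (\<Sum>j\<le>n. \<Sum>k\<le>n. sM (t ^ (j + k)) (?P j k))"
    by (simp add: d th M.scale_right_distrib M.scale_right_diff_distrib sum.distrib sum_subtractf)
  then have "?S (rep_D \<theta> (?S u) (?S v) w + \<theta> (?S v) (?S w) u - \<theta> (?S u) (?S w) v)
      = (\<Sum>i\<le>n. \<Sum>j\<le>n. \<Sum>k\<le>n. sL (t ^ (i + j + k)) (U i (?P j k)))"
    by (simp only: power_family_def linear_simps[OF lin])
       (simp add: scale_sum_right power_add mult.assoc)
  moreover have "?S (H (?S u) (?S v) (?S w))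
      = (\<Sum>i\<le>n. \<Sum>j\<le>n. \<Sum>k\<le>n. \<Sum>l\<le>n. sL (t ^ (i + j + k + l)) (defect_term4 U u v w i j k l))"
    by (simp only: h) (simp add: power_family_def linear_simps[OF lin] scale_sum_right power_add mult.assoc
          defect_term4_def)
  moreover have "bracket_T \<theta> H ?S u v w
      = (rep_D \<theta> (?S u) (?S v) w + \<theta> (?S v) (?S w) u - \<theta> (?S u) (?S w) v) + H (?S u) (?S v) (?S w)"
    by (simp add: bracket_T_def)
  ultimately have "reynolds_defect ?S u v w
      = (\<Sum>i\<le>n. \<Sum>j\<le>n. \<Sum>k\<le>n. sL (t ^ (i + j + k)) (defect_term3 U u v w i j k))
        - (\<Sum>i\<le>n. \<Sum>j\<le>n. \<Sum>k\<le>n. \<Sum>l\<le>n. sL (t ^ (i + j + k + l)) (defect_term4 U u v w i j k l))"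
    by (simp only: reynolds_defect_eq b linear_simps[OF power_family_linear[OF lin]])
       (simp add: defect_term3_def scale_right_diff_distrib sum_subtractf algebra_simps)
  also have "\<dots> =
      (\<Sum>x\<in>?B3. sL (t ^ (case x of (i, j, k) \<Rightarrow> i + j + k)) (case x of (i, j, k) \<Rightarrow> defect_term3 U u v w i j k))
      - (\<Sum>x\<in>?B4. sL (t ^ (case x of (i, j, k, l) \<Rightarrow> i + j + k + l))
                   (case x of (i, j, k, l) \<Rightarrow> defect_term4 U u v w i j k l))"
    by (simp add: sum.cartesian_product split_def)
  also have "(\<Sum>x\<in>?B3. sL (t ^ (case x of (i, j, k) \<Rightarrow> i + j + k)) (case x of (i, j, k) \<Rightarrow> defect_term3 U u v w i j k))
      = (\<Sum>p\<le>N. sL (t ^ p) (\<Sum>x | (case x of (i, j, k) \<Rightarrow> i + j + k) = p.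
                    case x of (i, j, k) \<Rightarrow> defect_term3 U u v w i j k))"
  proof (rule sum_collect_by_degree)
    show "(case x of (i, j, k) \<Rightarrow> defect_term3 U u v w i j k) = 0" if "x \<notin> ?B3" for x
      using that zero linear_simps(4)[OF lin]
      by (cases x) (auto simp: defect_term3_def br_simps rep_simps D_simps not_le)
  next
    show "finite {x. (case x of (i, j, k) \<Rightarrow> i + j + k) = p}" for p :: nat
      using finite_triples[of p] by (simp add: split_def)
  qed (use N in auto)
  also have "(\<Sum>x\<in>?B4. sL (t ^ (case x of (i, j, k, l) \<Rightarrow> i + j + k + l))
                   (case x of (i, j, k, l) \<Rightarrow> defect_term4 U u v w i j k l))
      = (\<Sum>p\<le>N. sL (t ^ p) (\<Sum>x | (case x of (i, j, k, l) \<Rightarrow> i + j + k + l) = p.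
                    case x of (i, j, k, l) \<Rightarrow> defect_term4 U u v w i j k l))"
  proof (rule sum_collect_by_degree)
    show "(case x of (i, j, k, l) \<Rightarrow> defect_term4 U u v w i j k l) = 0" if "x \<notin> ?B4" for x
      using that zero linear_simps(4)[OF lin]
      by (cases x) (auto simp: defect_term4_def H_simps not_le)
  next
    show "finite {x. (case x of (i, j, k, l) \<Rightarrow> i + j + k + l) = p}" for p :: nat
      using finite_quadruples[of p] by (simp add: split_def)
  qed (use N in auto)
  finally show ?thesis
    by (simp add: defect_coeff_def split_def scale_right_diff_distrib sum_subtractf)
qed

end

section \<open>The deformation equation by coefficients\<close>

lemma deform_nth:
  "fps_nth (deform n Ts X) p = (\<Sum>(i, q)\<in>{(i, q). i \<le> n \<and> i + q = p}. Ts i (fps_nth X q))"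
  by (simp add: deform_def)

lemma deform_const_nth:
  assumes "\<And>i. i \<le> n \<Longrightarrow> Ts i 0 = 0"
  shows "fps_nth (deform n Ts (fps_const u)) p = (if p \<le> n then Ts p u else 0)"
proof -
  have "{(i, q). i \<le> n \<and> i + q = p} \<subseteq> {..p} \<times> {..p}" by auto
  then have fin: "finite {(i, q). i \<le> n \<and> i + q = p}" by (rule finite_subset) simp
  have "(\<Sum>(i, q)\<in>{(i, q). i \<le> n \<and> i + q = p}. Ts i (fps_nth (fps_const u) q))
      = (\<Sum>(i, q)\<in>(if p \<le> n then {(p, 0)} else {}). Ts i (fps_nth (fps_const u) q))"
  proof (rule sum.mono_neutral_right[OF fin])
    show "\<forall>x\<in>{(i, q). i \<le> n \<and> i + q = p} - (if p \<le> n then {(p, 0)} else {}).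
        (case x of (i, q) \<Rightarrow> Ts i (fps_nth (fps_const u) q)) = 0"
    proof
      fix x assume x: "x \<in> {(i, q). i \<le> n \<and> i + q = p} - (if p \<le> n then {(p, 0)} else {})"
      obtain i q where iq: "x = (i, q)" by (cases x)
      then have "i \<le> n" "q \<noteq> 0" using x by (auto split: if_splits)
      then show "(case x of (i, q) \<Rightarrow> Ts i (fps_nth (fps_const u) q)) = 0"
        using assms iq by simp
    qed
  qed auto
  then show ?thesis by (simp add: deform_nth)
qed

lemma fps_trilinear_const_nth:
  assumes "\<And>x y. f x y 0 = 0"
  shows "fps_nth (fps_trilinear f X Y (fps_const w)) q
     = (\<Sum>(j, k)\<in>{(j, k). j + k = q}. f (fps_nth X j) (fps_nth Y k) w)"
proof -
  have "(\<Sum>(j, k, l)\<in>{(j, k, l). j + k + l = q}. f (fps_nth X j) (fps_nth Y k) (fps_nth (fps_const w) l))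
      = (\<Sum>(j, k, l)\<in>(\<lambda>(j, k). (j, k, 0)) ` {(j, k). j + k = q}.
            f (fps_nth X j) (fps_nth Y k) (fps_nth (fps_const w) l))"
    by (rule sum.mono_neutral_right[OF finite_triples]) (auto simp: assms image_iff)
  also have "\<dots> = (\<Sum>(j, k)\<in>{(j, k). j + k = q}. f (fps_nth X j) (fps_nth Y k) w)"
    by (subst sum.reindex) (auto simp: inj_on_def split_def)
  finally show ?thesis by (simp add: fps_trilinear_def)
qed

context lts_3_cocycle
begin

lemma deformation_equation_nth:
  fixes u v w :: 'm
  assumes lin: "\<And>i. i \<le> n \<Longrightarrow> Vector_Spaces.linear sM sL (Ts i)" and p: "p \<le> n"
  defines "x \<equiv> deform n Ts (fps_const u)" and "y \<equiv> deform n Ts (fps_const v)"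
    and "z \<equiv> deform n Ts (fps_const w)"
  shows "fps_nth (fps_trilinear br x y z) p
     - fps_nth (deform n Ts (fps_trilinear (rep_D \<theta>) x y (fps_const w)
         + fps_trilinear \<theta> y z (fps_const u) - fps_trilinear \<theta> x z (fps_const v)
         + fps_trilinear H x y z)) p = defect_coeff Ts p u v w"
proof -
  have nth: "fps_nth x i = Ts i u" "fps_nth y i = Ts i v" "fps_nth z i = Ts i w" if "i \<le> p" for i
    using that p linear_simps(4)[OF lin] by (simp_all add: x_def y_def z_def deform_const_nth)
  have b: "fps_nth (fps_trilinear br x y z) p
      = (\<Sum>(i, j, k)\<in>{(i, j, k). i + j + k = p}. br (Ts i u) (Ts j v) (Ts k w))"
    by (auto simp: fps_trilinear_def nth intro!: sum.cong)
  let ?P = "\<lambda>j k. rep_D \<theta> (Ts j u) (Ts k v) w + \<theta> (Ts j v) (Ts k w) u - \<theta> (Ts j u) (Ts k w) v"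
  have inner: "fps_nth (fps_trilinear (rep_D \<theta>) x y (fps_const w)
         + fps_trilinear \<theta> y z (fps_const u) - fps_trilinear \<theta> x z (fps_const v)
         + fps_trilinear H x y z) q
       = (\<Sum>(j, k)\<in>{(j, k). j + k = q}. ?P j k)
         + (\<Sum>(j, k, l)\<in>{(j, k, l). j + k + l = q}. H (Ts j u) (Ts k v) (Ts l w))"
    if q: "q \<le> p" for q
  proof -
    have "(\<Sum>(j, k)\<in>{(j, k). j + k = q}. rep_D \<theta> (fps_nth x j) (fps_nth y k) w)
        = (\<Sum>(j, k)\<in>{(j, k). j + k = q}. rep_D \<theta> (Ts j u) (Ts k v) w)"
      "(\<Sum>(j, k)\<in>{(j, k). j + k = q}. \<theta> (fps_nth y j) (fps_nth z k) u)
        = (\<Sum>(j, k)\<in>{(j, k). j + k = q}. \<theta> (Ts j v) (Ts k w) u)"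
      "(\<Sum>(j, k)\<in>{(j, k). j + k = q}. \<theta> (fps_nth x j) (fps_nth z k) v)
        = (\<Sum>(j, k)\<in>{(j, k). j + k = q}. \<theta> (Ts j u) (Ts k w) v)"
      "fps_nth (fps_trilinear H x y z) q
        = (\<Sum>(j, k, l)\<in>{(j, k, l). j + k + l = q}. H (Ts j u) (Ts k v) (Ts l w))"
      using q by (auto simp: nth fps_trilinear_def intro!: sum.cong)
    then show ?thesis
      by (simp add: fps_trilinear_const_nth rep_simps D_simps sum.distrib sum_subtractf split_def)
  qed
  have "fps_nth (deform n Ts (fps_trilinear (rep_D \<theta>) x y (fps_const w)
         + fps_trilinear \<theta> y z (fps_const u) - fps_trilinear \<theta> x z (fps_const v)
         + fps_trilinear H x y z)) p
     = (\<Sum>(i, q)\<in>{(i, q). i \<le> n \<and> i + q = p}.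
          (\<Sum>(j, k)\<in>{(j, k). j + k = q}. Ts i (?P j k))
          + (\<Sum>(j, k, l)\<in>{(j, k, l). j + k + l = q}. defect_term4 Ts u v w i j k l))"
    unfolding deform_nth
  proof (intro sum.cong refl, clarify)
    fix i q assume "i \<le> n" "p = i + q"
    then show "Ts i (fps_nth (fps_trilinear (rep_D \<theta>) x y (fps_const w)
         + fps_trilinear \<theta> y z (fps_const u) - fps_trilinear \<theta> x z (fps_const v)
         + fps_trilinear H x y z) q)
      = (\<Sum>(j, k)\<in>{(j, k). j + k = q}. Ts i (?P j k))
          + (\<Sum>(j, k, l)\<in>{(j, k, l). j + k + l = q}. defect_term4 Ts u v w i j k l)"
      by (subst inner) (simp_all add: linear_simps(1,6)[OF lin] defect_term4_def split_def)
  qed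
  also have "\<dots> = (\<Sum>(i, j, k)\<in>{(i, j, k). i + j + k = p}. Ts i (?P j k))
      + (\<Sum>(i, j, k, l)\<in>{(i, j, k, l). i + j + k + l = p}. defect_term4 Ts u v w i j k l)"
    using sum_nested_triples[OF p, of "\<lambda>i j k. Ts i (?P j k)"]
      sum_nested_quadruples[OF p, of "defect_term4 Ts u v w"]
    by (simp add: sum.distrib split_def)
  finally show ?thesis
    by (simp add: b defect_coeff_def defect_term3_def sum_subtractf split_def)
qed

lemma order_deformation_iff:
  "order_deformation sL br sM \<theta> H T n Ts \<longleftrightarrow>
     (\<forall>i\<le>n. Vector_Spaces.linear sM sL (Ts i)) \<and> Ts 0 = T \<and>
     (\<forall>p\<le>n. \<forall>u v w. defect_coeff Ts p u v w = 0)"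
proof (cases "\<forall>i\<le>n. Vector_Spaces.linear sM sL (Ts i)")
  case True
  have cutoff: "fps_cutoff (n + 1) X = fps_cutoff (n + 1) Y \<longleftrightarrow> (\<forall>p\<le>n. fps_nth X p - fps_nth Y p = 0)"
    for X Y :: "'l fps"
    by (auto simp: fps_eq_iff)
  have "(\<forall>p\<le>n. fps_nth (fps_trilinear br (deform n Ts (fps_const u)) (deform n Ts (fps_const v))
             (deform n Ts (fps_const w))) p
      - fps_nth (deform n Ts
           (fps_trilinear (rep_D \<theta>) (deform n Ts (fps_const u)) (deform n Ts (fps_const v)) (fps_const w)
            + fps_trilinear \<theta> (deform n Ts (fps_const v)) (deform n Ts (fps_const w)) (fps_const u)
            - fps_trilinear \<theta> (deform n Ts (fps_const u)) (deform n Ts (fps_const w)) (fps_const v)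
            + fps_trilinear H (deform n Ts (fps_const u)) (deform n Ts (fps_const v))
                (deform n Ts (fps_const w)))) p = 0)
      \<longleftrightarrow> (\<forall>p\<le>n. defect_coeff Ts p u v w = 0)" for u v w
    using deformation_equation_nth[of n Ts _ u v w] True by simp
  then have "order_deformation sL br sM \<theta> H T n Ts \<longleftrightarrow>
     (\<forall>i\<le>n. Vector_Spaces.linear sM sL (Ts i)) \<and> Ts 0 = T \<and>
     (\<forall>u v w. \<forall>p\<le>n. defect_coeff Ts p u v w = 0)"
    unfolding order_deformation_def Let_def cutoff by (simp only:)
  then show ?thesis by metis
qed (auto simp: order_deformation_def)

text \<open>
  Replacing the maps with index above \<open>n\<close> by zero makes the coefficient of degree \<open>n + 1\<close> equal to the
  obstruction, and the whole family a polynomial one.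
\<close>

definition truncate_family :: "nat \<Rightarrow> (nat \<Rightarrow> 'm \<Rightarrow> 'l) \<Rightarrow> nat \<Rightarrow> 'm \<Rightarrow> 'l" where
  "truncate_family n Ts i = (if i \<le> n then Ts i else (\<lambda>_. 0))"

lemma linear_zero: "Vector_Spaces.linear sM sL (\<lambda>_. 0)"
  by (simp add: Vector_Spaces.linear_iff vector_space_axioms M.vector_space_axioms)

lemma defect_coeff_cong:
  assumes "\<And>i. i \<le> p \<Longrightarrow> U i = V i"
  shows "defect_coeff U p u v w = defect_coeff V p u v w"
  unfolding defect_coeff_def
  by (intro arg_cong2[where f = "(-)"] sum.cong) (auto simp: defect_term3_def defect_term4_def assms)

definition coboundary1 :: "('m \<Rightarrow> 'l) \<Rightarrow> ('m \<Rightarrow> 'l) \<Rightarrow> 'm \<Rightarrow> 'm \<Rightarrow> 'm \<Rightarrow> 'l" where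
  "coboundary1 S f u v w = theta_T br \<theta> H S v w (f u) - theta_T br \<theta> H S u w (f v)
     + rep_D (theta_T br \<theta> H S) u v (f w) - f (bracket_T \<theta> H S u v w)"

text \<open>
  A tuple of total \<open>n + 1\<close> with an entry \<open>n + 1\<close> yields a term with \<open>f\<close> in one place and \<open>T\<^sub>0\<close> in all
  the others. The contribution of these tuples is the linearisation of the defect at \<open>T\<^sub>0\<close> in the direction
  \<open>f\<close>, and this is the coboundary of \<open>f\<close>.
\<close>

lemma
  assumes lin: "\<And>i. i \<le> n \<Longrightarrow> Vector_Spaces.linear sM sL (Ts i)"
  shows obstruction_eq: "obstruction br \<theta> H n Ts = cochain3 (defect_coeff (truncate_family n Ts) (n + 1))"
    and defect_coeff_extend: "Vector_Spaces.linear sM sL f \<Longrightarrow>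
      defect_coeff (Ts(n + 1 := f)) (n + 1) u v w
        = defect_coeff (truncate_family n Ts) (n + 1) u v w + coboundary1 (Ts 0) f u v w"
proof -
  let ?U = "truncate_family n Ts"
  \<comment> \<open>The obstruction. The values above \<open>n\<close> of a family that starts like \<open>Ts\<close> enter its coefficient of
    degree \<open>n + 1\<close> only through the seven tuples with the entry \<open>n + 1\<close>.\<close>
  let ?obs = "\<lambda>u v w.
     (\<Sum>(i, j, k)\<in>{(i, j, k). i \<le> n \<and> j \<le> n \<and> k \<le> n \<and> i + j + k = n + 1}. defect_term3 Ts u v w i j k)
     - (\<Sum>(i, j, k, l)\<in>{(i, j, k, l). i \<le> n \<and> j \<le> n \<and> k \<le> n \<and> l \<le> n \<and> i + j + k + l = n + 1}.
          defect_term4 Ts u v w i j k l)"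
  have split: "defect_coeff V (n + 1) u v w = ?obs u v w
      + (defect_term3 V u v w (n + 1) 0 0 + defect_term3 V u v w 0 (n + 1) 0 + defect_term3 V u v w 0 0 (n + 1))
      - (defect_term4 V u v w (n + 1) 0 0 0 + defect_term4 V u v w 0 (n + 1) 0 0
         + defect_term4 V u v w 0 0 (n + 1) 0 + defect_term4 V u v w 0 0 0 (n + 1))"
    if "\<And>i. i \<le> n \<Longrightarrow> V i = Ts i" for V u v w
  proof -
    have "(\<Sum>(i, j, k)\<in>{(i, j, k). i \<le> n \<and> j \<le> n \<and> k \<le> n \<and> i + j + k = n + 1}. defect_term3 V u v w i j k)
      = (\<Sum>(i, j, k)\<in>{(i, j, k). i \<le> n \<and> j \<le> n \<and> k \<le> n \<and> i + j + k = n + 1}. defect_term3 Ts u v w i j k)"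
      "(\<Sum>(i, j, k, l)\<in>{(i, j, k, l). i \<le> n \<and> j \<le> n \<and> k \<le> n \<and> l \<le> n \<and> i + j + k + l = n + 1}.
          defect_term4 V u v w i j k l)
      = (\<Sum>(i, j, k, l)\<in>{(i, j, k, l). i \<le> n \<and> j \<le> n \<and> k \<le> n \<and> l \<le> n \<and> i + j + k + l = n + 1}.
          defect_term4 Ts u v w i j k l)"
      by (rule sum.cong; auto simp: defect_term3_def defect_term4_def that)+
    then show ?thesis
      unfolding defect_coeff_def sum_triples_split_top sum_quadruples_split_top by simp
  qed
  have U: "?U i = Ts i" if "i \<le> n" for i
    using that by (simp add: truncate_family_def)
  have top: "?U (n + 1) = (\<lambda>_. 0)" by (simp add: truncate_family_def)
  have U0: "?U 0 = Ts 0" by (simp add: truncate_family_def)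
  have T0: "Ts 0 0 = 0" using linear_simps(4)[OF lin] by simp
  have obs: "defect_coeff ?U (n + 1) u v w = ?obs u v w" for u v w
  proof -
    have "defect_term3 ?U u v w (n + 1) 0 0 + defect_term3 ?U u v w 0 (n + 1) 0
        + defect_term3 ?U u v w 0 0 (n + 1) = 0"
      "defect_term4 ?U u v w (n + 1) 0 0 0 + defect_term4 ?U u v w 0 (n + 1) 0 0
        + defect_term4 ?U u v w 0 0 (n + 1) 0 + defect_term4 ?U u v w 0 0 0 (n + 1) = 0"
      by (simp_all only: defect_term3_def defect_term4_def top U0)
         (simp_all add: br_simps rep_simps D_simps H_simps T0)
    with split[OF U] show ?thesis by (simp only: add_0_right diff_0_right)
  qed
  show "obstruction br \<theta> H n Ts = cochain3 (defect_coeff ?U (n + 1))"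
    unfolding obstruction_def
    by (intro arg_cong[where f = cochain3] ext) (simp only: obs defect_term3_def defect_term4_def)
  assume f: "Vector_Spaces.linear sM sL f"
  have T: "Vector_Spaces.linear sM sL (Ts 0)" using lin by simp
  define V where "V = Ts(n + 1 := f)"
  have V: "V 0 = Ts 0" "V (n + 1) = f" "\<And>i. i \<le> n \<Longrightarrow> V i = Ts i" by (simp_all add: V_def)
  have th: "theta_T br \<theta> H (Ts 0) u w x
      = - graph_proj (Ts 0) (semidirect (graph (Ts 0) u) (x, 0) (graph (Ts 0) w))" for x
    using neg_theta_T_eq_semidirect[OF T, of u w x] by (metis minus_minus)
  have "defect_term3 V u v w (n + 1) 0 0 + defect_term3 V u v w 0 (n + 1) 0 + defect_term3 V u v w 0 0 (n + 1)
      - (defect_term4 V u v w (n + 1) 0 0 0 + defect_term4 V u v w 0 (n + 1) 0 0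
         + defect_term4 V u v w 0 0 (n + 1) 0 + defect_term4 V u v w 0 0 0 (n + 1))
      = coboundary1 (Ts 0) f u v w"
    unfolding coboundary1_def th theta_T_eq_semidirect[of "Ts 0" v w] D_T_eq_semidirect[OF T]
      defect_term3_def defect_term4_def bracket_T_def graph_proj_def semidirect_def
      graph_def fst_conv snd_conv V(1,2)
    by (simp only: linear_simps[OF f] linear_simps[OF T] rep_simps D_simps) (simp add: algebra_simps)
  with split[OF V(3)] show "defect_coeff (Ts(n + 1 := f)) (n + 1) u v w
      = defect_coeff ?U (n + 1) u v w + coboundary1 (Ts 0) f u v w"
    unfolding obs V_def[symmetric] by (simp only: add_diff_eq[symmetric])
qed

end

section \<open>Cochains and cohomology classes in degree three\<close>

definition cochain1 :: "('m \<Rightarrow> 'l::zero) \<Rightarrow> 'm list \<Rightarrow> 'l" where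
  "cochain1 f vs = (case vs of [x] \<Rightarrow> f x | _ \<Rightarrow> 0)"

lemma cochain3_simps [simp]: "cochain3 f [u, v, w] = f u v w"
  by (simp add: cochain3_def)

lemma cochain3_eq_0: "length vs \<noteq> 3 \<Longrightarrow> cochain3 f vs = 0"
  by (auto simp: cochain3_def split: list.splits)

lemma cochain3_inject: "cochain3 f = cochain3 g \<longleftrightarrow> (\<forall>u v w. f u v w = g u v w)"
proof
  assume "cochain3 f = cochain3 g"
  then have "cochain3 f [u, v, w] = cochain3 g [u, v, w]" for u v w by simp
  then show "\<forall>u v w. f u v w = g u v w" by simp
next
  assume "\<forall>u v w. f u v w = g u v w"
  then have "f = g" by blast
  then show "cochain3 f = cochain3 g" by simp
qed

lemma length_3_cases:
  assumes "length vs = 3" obtains u v w where "vs = [u, v, w]"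
  using assms by (auto simp: numeral_eq_Suc length_Suc_conv)

lemma length_5_cases:
  assumes "length vs = 5" obtains v1 v2 v3 v4 v5 where "vs = [v1, v2, v3, v4, v5]"
  using assms by (auto simp: numeral_eq_Suc length_Suc_conv)

lemma cochain3_in_cochains:
  assumes "trilinear sM sM sM sL f" "\<And>u w. f u u w = 0"
    and "\<And>u v w. f u v w + f v w u + f w u v = 0"
  shows "cochain3 f \<in> cochains sM sL 1"
proof -
  have "Vector_Spaces.linear sM sL (\<lambda>x. cochain3 f (vs[i := x]))" if len: "length vs = 3" and i: "i < 3" for vs i
  proof -
    obtain u v w where vs: "vs = [u, v, w]" using len by (rule length_3_cases)
    consider "i = 0" | "i = 1" | "i = 2" using i by linarith
    then show ?thesis
      using trilinear_linear[OF assms(1)] by cases (simp_all add: vs numeral_2_eq_2)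
  qed
  then show ?thesis
    using assms(2,3) by (simp add: cochains_def multilinear_def cochain3_eq_0)
qed

lemma cochains_0_eq: "cochains sM sL 0 = cochain1 ` {f. Vector_Spaces.linear sM sL f}"
proof (intro set_eqI iffI)
  fix \<phi> assume *: "\<phi> \<in> cochains sM sL 0"
  have lin: "Vector_Spaces.linear sM sL (\<lambda>x. \<phi> [x])"
  proof -
    have "\<forall>vs. length vs = 1 \<longrightarrow> Vector_Spaces.linear sM sL (\<lambda>x. \<phi> (vs[0 := x]))"
      using * by (simp add: cochains_def multilinear_def)
    from this[rule_format, of "[undefined]"] show ?thesis by simp
  qed
  from * have zero: "\<phi> vs = 0" if "length vs \<noteq> 1" for vs
    using that unfolding cochains_def multilinear_def by auto
  have "\<phi> = cochain1 (\<lambda>x. \<phi> [x])"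
    by (rule ext) (auto simp: cochain1_def zero split: list.splits)
  then show "\<phi> \<in> cochain1 ` {f. Vector_Spaces.linear sM sL f}" using lin by auto
next
  fix \<phi> assume "\<phi> \<in> cochain1 ` {f. Vector_Spaces.linear sM sL f}"
  then show "\<phi> \<in> cochains sM sL 0"
    by (auto simp: cochains_def multilinear_def cochain1_def length_Suc_conv split: list.splits)
qed

context lts_3_cocycle
begin

lemma coboundary_1_eq:
  "coboundary sL br \<theta> H S 1 \<phi> [u, v, w] =
     theta_T br \<theta> H S v w (\<phi> [u]) - theta_T br \<theta> H S u w (\<phi> [v])
       + rep_D (theta_T br \<theta> H S) u v (\<phi> [w]) - \<phi> [bracket_T \<theta> H S u v w]"
  by (simp add: coboundary_def drop_pair_def Let_def)

lemma coboundary_2_eq: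
  "coboundary sL br \<theta> H S 2 (cochain3 f) [v1, v2, v3, v4, v5] = coboundary3 S f v1 v2 v3 v4 v5"
proof -
  have "{1..2} = {1, 2::nat}" "{3..5} = {3, 4, 5::nat}" "{5..5} = {5::nat}" by auto
  then show ?thesis
  by (simp add: coboundary_def drop_pair_def Let_def coboundary3_def cochain3_def numeral_eq_Suc)
qed

lemma coboundary_1_cochain1:
  "coboundary sL br \<theta> H S 1 (cochain1 f) = cochain3 (coboundary1 S f)"
proof
  fix vs
  show "coboundary sL br \<theta> H S 1 (cochain1 f) vs = cochain3 (coboundary1 S f) vs"
  proof (cases "length vs = 3")
    case True
    then obtain u v w where "vs = [u, v, w]" by (rule length_3_cases)
    then show ?thesis using coboundary_1_eq[of S "cochain1 f"] by (simp add: coboundary1_def cochain1_def)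
  qed (simp add: coboundary_def cochain3_eq_0)
qed

lemma coboundaries_1_eq:
  "coboundaries sL br sM \<theta> H S 1 = (\<lambda>f. cochain3 (coboundary1 S f)) ` {f. Vector_Spaces.linear sM sL f}"
  unfolding coboundaries_def diff_self_eq_0 cochains_0_eq image_image coboundary_1_cochain1 ..

lemma coboundary_2_eq_0_iff:
  "coboundary sL br \<theta> H S 2 (cochain3 f) = (\<lambda>_. 0)
     \<longleftrightarrow> (\<forall>v1 v2 v3 v4 v5. coboundary3 S f v1 v2 v3 v4 v5 = 0)"
proof
  assume "coboundary sL br \<theta> H S 2 (cochain3 f) = (\<lambda>_. 0)"
  then show "\<forall>v1 v2 v3 v4 v5. coboundary3 S f v1 v2 v3 v4 v5 = 0"
    using coboundary_2_eq[of S f] by simp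
next
  assume *: "\<forall>v1 v2 v3 v4 v5. coboundary3 S f v1 v2 v3 v4 v5 = 0"
  show "coboundary sL br \<theta> H S 2 (cochain3 f) = (\<lambda>_. 0)"
  proof
    fix vs
    show "coboundary sL br \<theta> H S 2 (cochain3 f) vs = 0"
    proof (cases "length vs = 5")
      case True
      then obtain v1 v2 v3 v4 v5 where "vs = [v1, v2, v3, v4, v5]" by (rule length_5_cases)
      then show ?thesis using * coboundary_2_eq[of S f] by simp
    qed (simp add: coboundary_def)
  qed
qed

lemma cochain3_in_cocycles:
  assumes "cochain3 f \<in> cochains sM sL 1" "\<And>v1 v2 v3 v4 v5. coboundary3 S f v1 v2 v3 v4 v5 = 0"
  shows "cochain3 f \<in> cocycles sL br sM \<theta> H S 1"
  using assms coboundary_2_eq_0_iff[of S f] by (simp add: cocycles_def numeral_2_eq_2)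

lemma zero_in_cocycles:
  assumes "Vector_Spaces.linear sM sL S"
  shows "(\<lambda>_. 0) \<in> cocycles sL br sM \<theta> H S 1"
proof -
  have zero: "(\<lambda>_. 0) = cochain3 (\<lambda>_ _ _. 0 :: 'l)"
    by (auto simp: cochain3_def split: list.splits)
  show ?thesis unfolding zero
  proof (rule cochain3_in_cocycles)
    show "cochain3 (\<lambda>_ _ _. 0) \<in> cochains sM sL 1"
      by (rule cochain3_in_cochains) (simp_all add: trilinear_def linear_zero)
    show "coboundary3 S (\<lambda>_ _ _. 0) v1 v2 v3 v4 v5 = 0" for v1 v2 v3 v4 v5
      by (simp add: coboundary3_def linear_simps[OF theta_T_linear[OF assms]]
            linear_simps[OF D_T_linear[OF assms]])
  qed
qed

lemma coboundary1_diff: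
  assumes "Vector_Spaces.linear sM sL S"
  shows "coboundary1 S (\<lambda>x. f x - g x) u v w = coboundary1 S f u v w - coboundary1 S g u v w"
  by (simp add: coboundary1_def linear_simps[OF theta_T_linear[OF assms]]
        linear_simps[OF D_T_linear[OF assms]])

lemma coboundaries_1_diff:
  assumes S: "Vector_Spaces.linear sM sL S"
    and "\<phi> \<in> coboundaries sL br sM \<theta> H S 1" "\<psi> \<in> coboundaries sL br sM \<theta> H S 1"
  shows "(\<lambda>vs. \<phi> vs - \<psi> vs) \<in> coboundaries sL br sM \<theta> H S 1"
proof -
  obtain f g where fg: "Vector_Spaces.linear sM sL f" "Vector_Spaces.linear sM sL g"
    and "\<phi> = cochain3 (coboundary1 S f)" "\<psi> = cochain3 (coboundary1 S g)"
    using assms(2,3) unfolding coboundaries_1_eq by blast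
  then have "(\<lambda>vs. \<phi> vs - \<psi> vs) = cochain3 (coboundary1 S (\<lambda>x. f x - g x))"
    by (auto simp: cochain3_def coboundary1_diff[OF S] split: list.splits)
  moreover have "Vector_Spaces.linear sM sL (\<lambda>x. f x - g x)"
    using fg by (simp add: Vector_Spaces.linear_iff scale_right_diff_distrib)
  ultimately show ?thesis unfolding coboundaries_1_eq by blast
qed

lemma equiv_cohomologous:
  assumes S: "Vector_Spaces.linear sM sL S"
  shows "equiv (cocycles sL br sM \<theta> H S 1) (cohomologous sL br sM \<theta> H S 1)"
proof -
  define B where "B = coboundaries sL br sM \<theta> H S 1"
  note diff = coboundaries_1_diff[OF S, folded B_def]
  have "cochain3 (coboundary1 S (\<lambda>_. 0)) \<in> B"
    using linear_zero unfolding B_def coboundaries_1_eq by blast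
  from diff[OF this this] have zero: "(\<lambda>_. 0) \<in> B" by simp
  have neg: "(\<lambda>vs. \<psi> vs - \<phi> vs) \<in> B" if "(\<lambda>vs. \<phi> vs - \<psi> vs) \<in> B" for \<phi> \<psi> :: "'m list \<Rightarrow> 'l"
    using diff[OF zero that] by simp
  have trans: "(\<lambda>vs. \<phi> vs - \<chi> vs) \<in> B"
    if "(\<lambda>vs. \<phi> vs - \<psi> vs) \<in> B" "(\<lambda>vs. \<psi> vs - \<chi> vs) \<in> B" for \<phi> \<psi> \<chi> :: "'m list \<Rightarrow> 'l"
    using diff[OF that(1) neg[OF that(2)]] by simp
  show ?thesis
    unfolding cohomologous_def B_def[symmetric]
    by (rule equivI) (auto simp: refl_on_def sym_def trans_def zero intro: neg trans)
qed

lemma cohomology_class_eq_zero_iff: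
  assumes S: "Vector_Spaces.linear sM sL S" and \<phi>: "\<phi> \<in> cocycles sL br sM \<theta> H S 1"
  shows "cohomology_class sL br sM \<theta> H S 1 \<phi> = cohomology_class sL br sM \<theta> H S 1 (\<lambda>_. 0)
     \<longleftrightarrow> \<phi> \<in> coboundaries sL br sM \<theta> H S 1"
  unfolding cohomology_class_def eq_equiv_class_iff[OF equiv_cohomologous[OF S] \<phi> zero_in_cocycles[OF S]]
  using \<phi> zero_in_cocycles[OF S] by (simp add: cohomologous_def)

section \<open>The obstruction of a deformation\<close>

lemmas polynomial_map_br = polynomial_map_trilinear[of sL sL sL "\<lambda>_. br", OF br_trilinear polynomial_map_const]

lemmas polynomial_map_rep = M.polynomial_map_trilinear[of sL sL sM "\<lambda>_. \<theta>", OF rep_trilinear M.polynomial_map_const]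

lemmas polynomial_map_D =
  M.polynomial_map_trilinear[of sL sL sM "\<lambda>_. rep_D \<theta>", OF trilinear_rep_D[OF rep_trilinear] M.polynomial_map_const]

lemmas polynomial_map_H = M.polynomial_map_trilinear[of sL sL sL "\<lambda>_. H", OF H_trilinear M.polynomial_map_const]

lemma polynomial_map_bracket_T:
  assumes "\<And>u. polynomial_map sL (\<lambda>t. S t u)"
  shows "polynomial_map sM (\<lambda>t. bracket_T \<theta> H (S t) u v w)"
  unfolding bracket_T_def
  by (intro polynomial_map.add M.polynomial_map_diff polynomial_map_rep polynomial_map_D
        polynomial_map_H M.polynomial_map_const assms)

lemma polynomial_map_theta_T:
  assumes S: "\<And>t. Vector_Spaces.linear sM sL (S t)" and poly: "\<And>u. polynomial_map sL (\<lambda>t. S t u)"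
    and f: "polynomial_map sL f"
  shows "polynomial_map sL (\<lambda>t. theta_T br \<theta> H (S t) u v (f t))"
proof -
  have "polynomial_map sM (\<lambda>t. rep_D \<theta> (f t) (S t u) v - \<theta> (f t) (S t v) u + H (f t) (S t u) (S t v))"
    by (intro polynomial_map.add M.polynomial_map_diff polynomial_map_rep polynomial_map_D
        polynomial_map_H M.polynomial_map_const poly f)
  from polynomial_map_apply[OF S poly this] show ?thesis
    unfolding theta_T_def by (intro polynomial_map_diff polynomial_map_br poly f)
qed

lemma polynomial_map_coboundary3:
  assumes S: "\<And>t. Vector_Spaces.linear sM sL (S t)" and poly: "\<And>u. polynomial_map sL (\<lambda>t. S t u)"
    and R: "\<And>t. trilinear sM sM sM sL (R t)" and Rpoly: "\<And>u v w. polynomial_map sL (\<lambda>t. R t u v w)"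
  shows "polynomial_map sL (\<lambda>t. coboundary3 (S t) (R t) v1 v2 v3 v4 v5)"
proof -
  note R_apply = polynomial_map_trilinear[of sM sM sM R, OF R Rpoly]
  show ?thesis
    unfolding coboundary3_def rep_D_def
    by (intro polynomial_map.add polynomial_map_diff polynomial_map_theta_T[OF S poly]
          R_apply M.polynomial_map_const polynomial_map_bracket_T[OF poly])
qed

text \<open>
  For \<open>t \<noteq> 0\<close> the map \<open>R\<^sub>t\<close> is a nonzero multiple of the defect of \<open>S\<^sub>t\<close>, so it is a cochain with
  vanishing coboundary for \<open>S\<^sub>t\<close>. All these conditions are polynomial in \<open>t\<close> and carry over to
  \<open>t = 0\<close>.
\<close>

lemma leading_defect_cocycle:
  assumes S: "\<And>t. Vector_Spaces.linear sM sL (S t)" and poly: "\<And>u. polynomial_map sL (\<lambda>t. S t u)"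
    and Rpoly: "\<And>u v w. polynomial_map sL (\<lambda>t. R t u v w)"
    and E: "\<And>t u v w. reynolds_defect (S t) u v w = sL (t ^ m) (R t u v w)"
  shows "cochain3 (R 0) \<in> cocycles sL br sM \<theta> H (S 0) 1"
proof -
  have RE: "R t u v w = sL (inverse (t ^ m)) (reynolds_defect (S t) u v w)" if "t \<noteq> 0" for t u v w
    using that by (simp add: E)
  have lim: "f t = 0" if "polynomial_map sL f" "\<And>t. t \<noteq> 0 \<Longrightarrow> f t = 0" for f t
    using polynomial_map_eq_zero_at_zero[OF vector_space_axioms that] that(2) by (cases "t = 0") auto
  note d = reynolds_defect_linear[OF S, THEN linear_simps(1)] reynolds_defect_linear[OF S, THEN linear_simps(5)]
  have add1: "R t (u + u') v w - (R t u v w + R t u' v w) = 0" for t u v w u'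
    by (rule lim[where f = "\<lambda>t. R t (u + u') v w - (R t u v w + R t u' v w)"])
       (intro polynomial_map_diff polynomial_map.add Rpoly, simp add: RE d scale_right_distrib)
  have add2: "R t u (v + v') w - (R t u v w + R t u v' w) = 0" for t u v w v'
    by (rule lim[where f = "\<lambda>t. R t u (v + v') w - (R t u v w + R t u v' w)"])
       (intro polynomial_map_diff polynomial_map.add Rpoly, simp add: RE d scale_right_distrib)
  have add3: "R t u v (w + w') - (R t u v w + R t u v w') = 0" for t u v w w'
    by (rule lim[where f = "\<lambda>t. R t u v (w + w') - (R t u v w + R t u v w')"])
       (intro polynomial_map_diff polynomial_map.add Rpoly, simp add: RE d scale_right_distrib)
  have scale_poly: "polynomial_map sL (\<lambda>t. sL c (R t u v w))" for c u v w
  proof -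
    have "Vector_Spaces.linear sL sL (sL c)"
      by (simp add: Vector_Spaces.linear_iff vector_space_axioms scale_right_distrib mult.commute)
    from polynomial_map_apply[of sL "\<lambda>_. sL c", OF this polynomial_map_const Rpoly]
    show ?thesis .
  qed
  have scale1: "R t (sM c u) v w - sL c (R t u v w) = 0" for t c u v w
    by (rule lim[where f = "\<lambda>t. R t (sM c u) v w - sL c (R t u v w)"])
       (intro polynomial_map_diff scale_poly Rpoly, simp add: RE d mult.commute)
  have scale2: "R t u (sM c v) w - sL c (R t u v w) = 0" for t c u v w
    by (rule lim[where f = "\<lambda>t. R t u (sM c v) w - sL c (R t u v w)"])
       (intro polynomial_map_diff scale_poly Rpoly, simp add: RE d mult.commute)
  have scale3: "R t u v (sM c w) - sL c (R t u v w) = 0" for t c u v w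
    by (rule lim[where f = "\<lambda>t. R t u v (sM c w) - sL c (R t u v w)"])
       (intro polynomial_map_diff scale_poly Rpoly, simp add: RE d mult.commute)
  \<comment> \<open>Needed at \<open>t = 0\<close> too: the coboundary evaluates \<open>R\<^sub>t\<close> on brackets that vary with \<open>t\<close>, and is
    polynomial in \<open>t\<close> only because \<open>R\<^sub>t\<close> can be expanded in its arguments for every \<open>t\<close>.\<close>
  have R: "trilinear sM sM sM sL (R t)" for t
    using add1 add2 add3 scale1 scale2 scale3
    by (simp add: trilinear_def Vector_Spaces.linear_iff vector_space_axioms M.vector_space_axioms)
  show ?thesis
  proof (rule cochain3_in_cocycles)
    show "cochain3 (R 0) \<in> cochains sM sL 1"
    proof (rule cochain3_in_cochains[OF R])
      show "R 0 u u w = 0" for u w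
        by (rule lim[OF Rpoly]) (simp add: RE reynolds_defect_alt[OF S])
      show "R 0 u v w + R 0 v w u + R 0 w u v = 0" for u v w
        by (rule lim[where f = "\<lambda>t. R t u v w + R t v w u + R t w u v"])
           (intro polynomial_map.add Rpoly, simp add: RE reynolds_defect_cyclic[OF S] flip: scale_right_distrib)
    qed
    show "coboundary3 (S 0) (R 0) v1 v2 v3 v4 v5 = 0" for v1 v2 v3 v4 v5
    proof (rule lim[OF polynomial_map_coboundary3[OF S poly R Rpoly]])
      fix t :: 'k assume "t \<noteq> 0"
      note RE = RE[OF this]
      have "coboundary3 (S t) (R t) v1 v2 v3 v4 v5
          = sL (inverse (t ^ m)) (coboundary3 (S t) (reynolds_defect (S t)) v1 v2 v3 v4 v5)"
        by (simp only: coboundary3_def RE linear_simps[OF theta_T_linear[OF S]]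
              linear_simps[OF D_T_linear[OF S]] scale_right_distrib scale_right_diff_distrib)
      then show "coboundary3 (S t) (R t) v1 v2 v3 v4 v5 = 0" by (simp add: bianchi_identity[OF S])
    qed
  qed
qed

text \<open>
  The obstruction is the coefficient of \<open>t\<^sup>n\<^sup>+\<^sup>1\<close>, the lowest one that can be nonzero, in the defect
  of \<open>\<Sum>\<^sub>i t\<^sup>i T\<^sub>i\<close>.
\<close>

lemma obstruction_in_cocycles:
  assumes "order_deformation sL br sM \<theta> H T n Ts"
  shows "obstruction br \<theta> H n Ts \<in> cocycles sL br sM \<theta> H T 1"
proof -
  have lin: "\<And>i. i \<le> n \<Longrightarrow> Vector_Spaces.linear sM sL (Ts i)" and T: "Ts 0 = T"
    and zero: "\<And>p u v w. p \<le> n \<Longrightarrow> defect_coeff Ts p u v w = 0"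
    using assms unfolding order_deformation_iff by auto
  define U where "U = truncate_family n Ts"
  have U: "Vector_Spaces.linear sM sL (U i)" for i
    using lin by (simp add: U_def truncate_family_def linear_zero)
  define S where "S = power_family n U"
  \<comment> \<open>Degrees up to \<open>4 n + (n + 1)\<close> are summed, so that exactly \<open>4 n + 1\<close> coefficients remain above the
    vanishing ones; those above \<open>4 n\<close> are zero.\<close>
  define R where "R = (\<lambda>t u v w. \<Sum>q\<le>4 * n. sL (t ^ q) (defect_coeff U (q + (n + 1)) u v w))"
  have S0: "S 0 = T"
  proof
    fix u
    have "S 0 u = (\<Sum>i\<le>n. if i = 0 then U 0 u else 0)"
      unfolding S_def power_family_def by (intro sum.cong) auto
    then show "S 0 u = T u" using T by (simp add: U_def truncate_family_def)
  qed
  have R0: "R 0 = defect_coeff U (n + 1)"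
  proof (intro ext)
    fix u v w
    have "R 0 u v w = (\<Sum>q\<le>4 * n. if q = 0 then defect_coeff U (n + 1) u v w else 0)"
      unfolding R_def by (intro sum.cong) auto
    then show "R 0 u v w = defect_coeff U (n + 1) u v w" by simp
  qed
  have "reynolds_defect (S t) u v w = sL (t ^ (n + 1)) (R t u v w)" for t u v w
  proof -
    have low: "defect_coeff U p u v w = 0" if "p \<le> n" for p
      using zero[OF that] defect_coeff_cong[of p U Ts] that by (simp add: U_def truncate_family_def)
    have "reynolds_defect (S t) u v w
        = (\<Sum>p\<le>4 * n + (n + 1). sL (t ^ p) (defect_coeff U p u v w))"
      unfolding S_def using U
      by (intro reynolds_defect_power_family) (auto simp: U_def truncate_family_def)
    also have "\<dots> = (\<Sum>p = 0 + (n + 1)..4 * n + (n + 1). sL (t ^ p) (defect_coeff U p u v w))"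
      by (rule sum.mono_neutral_right) (auto simp: low)
    also have "\<dots> = (\<Sum>q = 0..4 * n. sL (t ^ (q + (n + 1))) (defect_coeff U (q + (n + 1)) u v w))"
      by (rule sum.shift_bounds_cl_nat_ivl)
    also have "\<dots> = sL (t ^ (n + 1)) (R t u v w)"
      unfolding R_def scale_sum_right atLeast0AtMost
      by (intro sum.cong refl) (simp add: power_add mult.commute mult.left_commute)
    finally show ?thesis .
  qed
  moreover have "polynomial_map sL (\<lambda>t. S t u)" for u
    unfolding S_def power_family_def by (intro polynomial_map_sum polynomial_map.monomial)
  moreover have "polynomial_map sL (\<lambda>t. R t u v w)" for u v w
    unfolding R_def by (intro polynomial_map_sum polynomial_map.monomial)
  moreover have "Vector_Spaces.linear sM sL (S t)" for t
    unfolding S_def by (rule power_family_linear) (rule U)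
  ultimately have "cochain3 (R 0) \<in> cocycles sL br sM \<theta> H (S 0) 1"
    by (intro leading_defect_cocycle)
  then show ?thesis using obstruction_eq[OF lin] by (simp add: S0 R0 U_def)
qed

lemma extendable_iff_obstruction_coboundary:
  assumes "order_deformation sL br sM \<theta> H T n Ts"
  shows "extendable sL br sM \<theta> H T n Ts
     \<longleftrightarrow> obstruction br \<theta> H n Ts \<in> coboundaries sL br sM \<theta> H T 1"
proof -
  have lin: "\<And>i. i \<le> n \<Longrightarrow> Vector_Spaces.linear sM sL (Ts i)" and T: "Ts 0 = T"
    and zero: "\<And>p u v w. p \<le> n \<Longrightarrow> defect_coeff Ts p u v w = 0"
    using assms unfolding order_deformation_iff by auto
  have Tlin: "Vector_Spaces.linear sM sL T" using lin[of 0] T by simp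
  let ?c = "defect_coeff (truncate_family n Ts) (n + 1)"
  have obs: "obstruction br \<theta> H n Ts = cochain3 ?c"
    using lin by (rule obstruction_eq)
  have ext: "order_deformation sL br sM \<theta> H T (n + 1) (Ts(n + 1 := f))
      \<longleftrightarrow> cochain3 ?c = cochain3 (coboundary1 T (\<lambda>x. - f x))"
    if f: "Vector_Spaces.linear sM sL f" for f
  proof -
    have low: "defect_coeff (Ts(n + 1 := f)) p u v w = 0" if "p \<le> n" for p u v w
      using zero[OF that] defect_coeff_cong[of p "Ts(n + 1 := f)" Ts] that by simp
    have neg: "coboundary1 T (\<lambda>x. - f x) u v w = - coboundary1 T f u v w" for u v w
      by (simp add: coboundary1_def linear_simps[OF theta_T_linear[OF Tlin]]
            linear_simps[OF D_T_linear[OF Tlin]])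
    have "order_deformation sL br sM \<theta> H T (n + 1) (Ts(n + 1 := f))
        \<longleftrightarrow> (\<forall>u v w. defect_coeff (Ts(n + 1 := f)) (n + 1) u v w = 0)"
      unfolding order_deformation_iff using lin T f low by (auto simp: le_Suc_eq)
    also have "\<dots> \<longleftrightarrow> (\<forall>u v w. ?c u v w = coboundary1 T (\<lambda>x. - f x) u v w)"
      by (simp only: defect_coeff_extend[OF lin f] T neg eq_neg_iff_add_eq_0)
    finally show ?thesis by (simp only: cochain3_inject)
  qed
  have neg_lin: "Vector_Spaces.linear sM sL (\<lambda>x. - f x)" if "Vector_Spaces.linear sM sL f" for f
    using that by (simp add: Vector_Spaces.linear_iff)
  have "extendable sL br sM \<theta> H T n Ts
      \<longleftrightarrow> (\<exists>f. Vector_Spaces.linear sM sL f \<and> cochain3 ?c = cochain3 (coboundary1 T (\<lambda>x. - f x)))"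
    unfolding extendable_def using ext by blast
  also have "\<dots> \<longleftrightarrow> (\<exists>g. Vector_Spaces.linear sM sL g \<and> cochain3 ?c = cochain3 (coboundary1 T g))"
  proof
    assume "\<exists>g. Vector_Spaces.linear sM sL g \<and> cochain3 ?c = cochain3 (coboundary1 T g)"
    then obtain g where "Vector_Spaces.linear sM sL g" "cochain3 ?c = cochain3 (coboundary1 T g)"
      by blast
    then show "\<exists>f. Vector_Spaces.linear sM sL f \<and> cochain3 ?c = cochain3 (coboundary1 T (\<lambda>x. - f x))"
      using neg_lin by (intro exI[of _ "\<lambda>x. - g x"]) simp
  qed (use neg_lin in blast)
  finally show ?thesis
    unfolding obs coboundaries_1_eq by (simp only: image_iff mem_Collect_eq Bex_def)
qed

end

theorem theorem5p3:
  fixes sL :: "'k::field_char_0 \<Rightarrow> 'l::ab_group_add \<Rightarrow> 'l"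
    and br :: "'l \<Rightarrow> 'l \<Rightarrow> 'l \<Rightarrow> 'l"
    and sM :: "'k \<Rightarrow> 'm::ab_group_add \<Rightarrow> 'm"
    and \<theta> :: "'l \<Rightarrow> 'l \<Rightarrow> 'm \<Rightarrow> 'm"
    and H :: "'l \<Rightarrow> 'l \<Rightarrow> 'l \<Rightarrow> 'm"
    and T :: "'m \<Rightarrow> 'l"
    and Ts :: "nat \<Rightarrow> 'm \<Rightarrow> 'l"
    and n :: nat
  assumes "lie_triple_system sL br"
    and "lts_representation sL br sM \<theta>"
    and "lts_3_cocycle sL br sM \<theta> H"
    and "generalized_reynolds sL br sM \<theta> H T"
    and "order_deformation sL br sM \<theta> H T n Ts"
  shows "cohomology_class sL br sM \<theta> H T 1 (obstruction br \<theta> H n Ts)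
           \<in> cohomology sL br sM \<theta> H T 1 \<and>
         (extendable sL br sM \<theta> H T n Ts \<longleftrightarrow>
            cohomology_class sL br sM \<theta> H T 1 (obstruction br \<theta> H n Ts)
              = cohomology_class sL br sM \<theta> H T 1 (\<lambda>_. 0))"
proof -
  interpret generalized_reynolds sL br sM \<theta> H T by fact
  note cocycle = obstruction_in_cocycles[OF assms(5)]
  have "cohomology_class sL br sM \<theta> H T 1 (obstruction br \<theta> H n Ts) \<in> cohomology sL br sM \<theta> H T 1"
    unfolding cohomology_class_def cohomology_def using cocycle by (rule quotientI)
  then show ?thesis
    using extendable_iff_obstruction_coboundary[OF assms(5)]
      cohomology_class_eq_zero_iff[OF T_linear cocycle] by blast
qed

end
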